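(* Let $n\ge1$ and let $\Gamma$, $\lambda$ and $K$ be as in the context. For every $p\in\Gamma$ the sequence $p,Kp,K^2p,\ldots$ is $\lambda$-uniformly distributed, i.e., for every continuous $f:\Gamma\to\mathbb{R}$, $\lim_{k\to\infty}\frac1k\sum_{i=0}^{k-1}f(K^ip)=\int_\Gamma f\,d\lambda$.
   Context: $\Gamma=\{(\alpha_1,\ldots,\alpha_n)\in\mathbb{R}^n:0\le\alpha_n\le\cdots\le\alpha_1\le1\}$, $\lambda$ Lebesgue measure normalized with $\lambda(\Gamma)=1$. The tent map $T:\Gamma\to\Gamma$ is $T(\alpha_1,\ldots,\alpha_n)=(\alpha_1+\alpha_n,\alpha_1-\alpha_n,\alpha_2-\alpha_n,\ldots,\alpha_{n-1}-\alpha_n)$ if $\alpha_1+\alpha_n\le1$, and $(2-\alpha_1-\alpha_n,\alpha_1-\alpha_n,\ldots,\alpha_{n-1}-\alpha_n)$ if $\alpha_1+\alpha_n\ge1$. Its restrictions to $\Gamma\cap\{\alpha_1+\alpha_n\le1\}$ and $\Gamma\cap\{\alpha_1+\alpha_n\ge1\}$ are affine bijections onto $\Gamma$, with inverses $\tau_0,\tau_1$. $\Gamma^o=\{\alpha\in\Gamma:\alpha_1<1\}$, $v_0=(0,\ldots,0)$, $v_{-1}$ the unique fixed point of $\tau_1$ in $\Gamma$. The sets $\{v_{-1}\}$ and $\tau_1^k\tau_0\Gamma^o$ ($k\ge0$) partition $\Gamma$; $K:\Gamma\to\Gamma$ is defined by $Kv_{-1}=v_0$ and $K=\tau_0^k\tau_1\circ(\tau_1^k\tau_0)^{-1}$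 on $\tau_1^k\tau_0\Gamma^o$. *)

theory Defs
  imports "HOL-Analysis.Analysis"
begin

text \<open>
  Vectors of \<open>n\<close> reals are elements of \<open>real ^ 'n\<close> with \<open>n = CARD('n) \<ge> 1\<close>. The linear order of
  the finite index type \<open>'n\<close> (for instance a numeral type) plays the role of
  \<open>1 < 2 < \<dots> < n\<close>.
\<close>

definition first_ix :: "'n::{finite,wellorder}" where
  "first_ix = Min UNIV"

definition last_ix :: "'n::{finite,wellorder}" where
  "last_ix = Max UNIV"

text \<open>The index \<open>i - 1\<close>; meaningful only for \<open>i \<noteq> first_ix\<close>.\<close>

definition prev_ix :: "'n::{finite,wellorder} \<Rightarrow> 'n" where
  "prev_ix i = Max {j. j < i}"

definition \<Gamma> :: "(real ^ 'n::{finite,wellorder}) set" where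
  "\<Gamma> = {\<alpha>. 0 \<le> \<alpha> $ last_ix \<and> (\<forall>i j. i \<le> j \<longrightarrow> \<alpha> $ j \<le> \<alpha> $ i) \<and> \<alpha> $ first_ix \<le> 1}"

definition \<Gamma>o :: "(real ^ 'n::{finite,wellorder}) set" where
  "\<Gamma>o = {\<alpha> \<in> \<Gamma>. \<alpha> $ first_ix < 1}"

text \<open>
  Lebesgue measure on \<open>\<Gamma>\<close>, scaled to total mass 1. Its underlying space is \<open>\<Gamma>\<close> itself, so that
  integrals do not depend on values of the integrand outside \<open>\<Gamma>\<close>.
\<close>

definition \<Gamma>_measure :: "(real ^ 'n::{finite,wellorder}) measure" where
  "\<Gamma>_measure = uniform_measure (lebesgue_on \<Gamma>) \<Gamma>"

definition tent :: "(real ^ 'n::{finite,wellorder}) \<Rightarrow> (real ^ 'n::{finite,wellorder})" where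
  "tent \<alpha> = (\<chi> i.
     if i = first_ix then
       (if \<alpha> $ first_ix + \<alpha> $ last_ix \<le> 1
        then \<alpha> $ first_ix + \<alpha> $ last_ix
        else 2 - \<alpha> $ first_ix - \<alpha> $ last_ix)
     else \<alpha> $ (prev_ix i) - \<alpha> $ last_ix)"

text \<open>The two inverse branches; their values are only meaningful on \<open>\<Gamma>\<close>.\<close>

definition \<tau>\<^sub>0 :: "(real ^ 'n::{finite,wellorder}) \<Rightarrow> (real ^ 'n::{finite,wellorder})" where
  "\<tau>\<^sub>0 = inv_into {\<alpha> \<in> \<Gamma>. \<alpha> $ first_ix + \<alpha> $ last_ix \<le> 1} tent"

definition \<tau>\<^sub>1 :: "(real ^ 'n::{finite,wellorder}) \<Rightarrow> (real ^ 'n::{finite,wellorder})" where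
  "\<tau>\<^sub>1 = inv_into {\<alpha> \<in> \<Gamma>. \<alpha> $ first_ix + \<alpha> $ last_ix \<ge> 1} tent"

definition v_minus1 :: "real ^ 'n::{finite,wellorder}" where
  "v_minus1 = (THE v. v \<in> \<Gamma> \<and> \<tau>\<^sub>1 v = v)"

text \<open>
  The sets \<open>{v_minus1}\<close> and \<open>\<tau>\<^sub>1\<^sup>k \<tau>\<^sub>0 \<Gamma>o\<close> partition \<open>\<Gamma>\<close>, so the \<open>k\<close> below is
  unique for \<open>p \<in> \<Gamma> - {v_minus1}\<close>. The vector \<open>v\<^sub>0\<close> is \<open>0\<close>.
\<close>

definition Kmap :: "(real ^ 'n::{finite,wellorder}) \<Rightarrow> (real ^ 'n::{finite,wellorder})" where
  "Kmap p =
    (if p = v_minus1 then 0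
     else let k = (THE k. p \<in> ((\<tau>\<^sub>1 ^^ k) \<circ> \<tau>\<^sub>0) ` \<Gamma>o)
          in ((\<tau>\<^sub>0 ^^ k) \<circ> \<tau>\<^sub>1) (inv_into \<Gamma>o ((\<tau>\<^sub>1 ^^ k) \<circ> \<tau>\<^sub>0) p))"

end

theory Submission
  imports Defs
begin

text \<open>
  In barycentric coordinates the two inverse branches \<open>\<tau>\<^sub>0, \<tau>\<^sub>1\<close> of the tent map bisect the simplex,
  and \<open>K\<close> is determined by \<open>K \<circ> \<tau>\<^sub>0 = \<tau>\<^sub>1\<close> on \<open>\<Gamma>o\<close> and \<open>K \<circ> \<tau>\<^sub>1 = \<tau>\<^sub>0 \<circ> K\<close>. Hence the \<open>K\<close>-orbit
  of \<open>\<tau>\<^sub>0\<^sup>m y\<close> runs, block after block, through the distinct points of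
  \<open>T\<^sup>-\<^sup>m y, T\<^sup>-\<^sup>m (K y), T\<^sup>-\<^sup>m (K\<^sup>2 y), \<dots>\<close>, and every orbit reaches a point \<open>\<tau>\<^sub>0\<^sup>m y\<close>. It
  therefore suffices that, uniformly in \<open>y\<close>, the points of \<open>T\<^sup>-\<^sup>m y\<close> become equidistributed.

  Counted with multiplicity, they do: \<open>f \<mapsto> (f \<circ> \<tau>\<^sub>0 + f \<circ> \<tau>\<^sub>1) / 2\<close> preserves the integral, and its
  iterates flatten \<open>f\<close>, because both branches are nonexpansive for the \<open>\<ell>\<^sup>1\<close> distance of barycentric
  coordinates and \<open>\<tau>\<^sub>0\<^sup>n\<close> halves it. Multiplicities occur only over boundary points. The preimages
  of interior points are interior, and a fixed positive proportion of the \<open>L\<close>-th preimages of any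
  point is interior, so boundary points are exponentially rare among the preimages.
\<close>

section \<open>Barycentric coordinates\<close>

text \<open>Counts from 0 in increasing order, so the coordinate alpha_k of a vector is its entry at
  \<open>ix (k - 1)\<close>.\<close>

definition ix :: "nat \<Rightarrow> 'n::{finite,wellorder}" where
  "ix = enumerate UNIV"

lemma ix_bij: "bij_betw (ix :: nat \<Rightarrow> 'n::{finite,wellorder}) {..<CARD('n)} UNIV"
  unfolding ix_def by (rule finite_bij_enumerate) simp

lemma ix_exhaust:
  obtains k where "k < CARD('n)" "(i :: 'n::{finite,wellorder}) = ix k"
  using ix_bij[where 'n='n] by (metis UNIV_I bij_betw_imp_surj_on imageE lessThan_iff)

lemma ix_less_iff:
  assumes "j < CARD('n)" "k < CARD('n)"
  shows "(ix j :: 'n::{finite,wellorder}) < ix k \<longleftrightarrow> j < k"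
  using assms unfolding ix_def by (simp add: finite_enumerate_mono_iff)

lemma ix_le_iff:
  assumes "j < CARD('n)" "k < CARD('n)"
  shows "(ix j :: 'n::{finite,wellorder}) \<le> ix k \<longleftrightarrow> j \<le> k"
  using ix_less_iff[OF assms(2,1)] by (simp add: linorder_not_less[symmetric])

lemma first_ix_eq: "(first_ix :: 'n::{finite,wellorder}) = ix 0"
  unfolding first_ix_def
proof (rule Min_eqI)
  fix y :: 'n
  obtain k where "k < CARD('n)" "y = ix k" by (rule ix_exhaust)
  then show "ix 0 \<le> y" by (simp add: ix_le_iff)
qed auto

lemma last_ix_eq: "(last_ix :: 'n::{finite,wellorder}) = ix (CARD('n) - 1)"
  unfolding last_ix_def
proof (rule Max_eqI)
  fix y :: 'n
  obtain k where "k < CARD('n)" "y = ix k" by (rule ix_exhaust)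
  then show "y \<le> ix (CARD('n) - 1)" by (simp add: ix_le_iff)
qed auto

lemma prev_ix_Suc:
  assumes "Suc k < CARD('n)"
  shows "prev_ix (ix (Suc k) :: 'n::{finite,wellorder}) = ix k"
  unfolding prev_ix_def
proof (rule Max_eqI)
  fix y :: 'n
  assume y: "y \<in> {j. j < ix (Suc k)}"
  obtain l where "l < CARD('n)" "y = ix l" by (rule ix_exhaust)
  with y assms show "y \<le> ix k" by (simp add: ix_le_iff ix_less_iff)
qed (use assms in \<open>auto simp: ix_less_iff\<close>)

text \<open>Coordinates padded by \<open>\<alpha>\<^sub>0 = 1\<close> and \<open>\<alpha>\<^sub>k = 0\<close> for \<open>k > n\<close>. The successive differences
  \<open>bary \<alpha> 0, \<dots>, bary \<alpha> n\<close> are then the barycentric coordinates with respect to the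
  vertices of \<open>\<Gamma>\<close>.\<close>

definition ext :: "real ^ 'n::{finite,wellorder} \<Rightarrow> nat \<Rightarrow> real" where
  "ext \<alpha> k = (if k = 0 then 1 else if k \<le> CARD('n) then \<alpha> $ ix (k - 1) else 0)"

definition bary :: "real ^ 'n::{finite,wellorder} \<Rightarrow> nat \<Rightarrow> real" where
  "bary \<alpha> k = ext \<alpha> k - ext \<alpha> (Suc k)"

lemma ext_0 [simp]: "ext \<alpha> 0 = 1"
  by (simp add: ext_def)

lemma ext_gt: "k > CARD('n) \<Longrightarrow> ext (\<alpha> :: real ^ 'n::{finite,wellorder}) k = 0"
  by (simp add: ext_def)

lemma ext_first: "ext (\<alpha> :: real ^ 'n::{finite,wellorder}) (Suc 0) = \<alpha> $ first_ix"
  by (simp add: ext_def first_ix_eq Suc_le_eq)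

lemma ext_last: "ext (\<alpha> :: real ^ 'n::{finite,wellorder}) CARD('n) = \<alpha> $ last_ix"
  by (simp add: ext_def last_ix_eq)

lemma bary_0: "bary \<alpha> 0 = 1 - \<alpha> $ first_ix"
  by (simp add: bary_def ext_first)

lemma bary_last: "bary (\<alpha> :: real ^ 'n::{finite,wellorder}) CARD('n) = \<alpha> $ last_ix"
  by (simp add: bary_def ext_last ext_gt)

lemma sum_bary_tail:
  assumes "k \<le> Suc CARD('n)"
  shows "(\<Sum>j=k..CARD('n). bary (\<alpha> :: real ^ 'n::{finite,wellorder}) j) = ext \<alpha> k"
  using sum_Suc_diff[of k "CARD('n)" "\<lambda>j. - ext \<alpha> j"] assms
  by (simp add: bary_def ext_gt)

lemma sum_bary: "(\<Sum>j\<le>CARD('n). bary (\<alpha> :: real ^ 'n::{finite,wellorder}) j) = 1"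
  using sum_bary_tail[of 0 \<alpha>] by (simp add: atMost_atLeast0)

text \<open>Tail sums of the coordinates 1 to n give back the entries. Coordinate 0 can be skipped
  because it is 1 minus the others; this spares a case in later equalities of points.\<close>

lemma bary_inject:
  fixes \<alpha> \<beta> :: "real ^ 'n::{finite,wellorder}"
  assumes "\<And>k. 1 \<le> k \<Longrightarrow> k \<le> CARD('n) \<Longrightarrow> bary \<alpha> k = bary \<beta> k"
  shows "\<alpha> = \<beta>"
proof (rule vec_eq_iff[THEN iffD2], rule allI)
  fix i :: 'n
  obtain k where k: "k < CARD('n)" "i = ix k" by (rule ix_exhaust)
  have "ext \<alpha> (Suc k) = ext \<beta> (Suc k)"
    using sum_bary_tail[of "Suc k" \<alpha>] sum_bary_tail[of "Suc k" \<beta>] k assms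
      sum.cong[of "{Suc k..CARD('n)}" "{Suc k..CARD('n)}" "bary \<alpha>" "bary \<beta>"] by simp
  then show "\<alpha> $ i = \<beta> $ i" using k by (simp add: ext_def)
qed

text \<open>The chain 1 >= alpha_1 >= ... >= alpha_n >= 0 consists of n + 1 inequalities, one for
  each difference.\<close>

lemma Gamma_iff:
  fixes \<alpha> :: "real ^ 'n::{finite,wellorder}"
  shows "\<alpha> \<in> \<Gamma> \<longleftrightarrow> (\<forall>k\<le>CARD('n). 0 \<le> bary \<alpha> k)"
proof
  assume a: "\<alpha> \<in> \<Gamma>"
  show "\<forall>k\<le>CARD('n). 0 \<le> bary \<alpha> k"
  proof (intro allI impI)
    fix k assume k: "k \<le> CARD('n)"
    consider "k = 0" | "k = CARD('n)" | "0 < k" "k < CARD('n)" using k by linarith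
    then show "0 \<le> bary \<alpha> k"
    proof cases
      case 3
      then have "(ix (k - 1) :: 'n) \<le> ix k" by (simp add: ix_le_iff)
      then show ?thesis using a 3 by (simp add: \<Gamma>_def bary_def ext_def)
    qed (use a in \<open>auto simp: bary_0 bary_last \<Gamma>_def\<close>)
  qed
next
  assume a: "\<forall>k\<le>CARD('n). 0 \<le> bary \<alpha> k"
  have s: "ext \<alpha> (Suc k) \<le> ext \<alpha> k" for k
  proof (cases "k \<le> CARD('n)")
    case True
    then show ?thesis using a by (auto simp: bary_def)
  qed (simp add: ext_gt)
  have anti: "\<alpha> $ j \<le> \<alpha> $ i" if "i \<le> j" for i j
  proof -
    obtain k where k: "k < CARD('n)" "i = ix k" by (rule ix_exhaust)
    obtain l where l: "l < CARD('n)" "j = ix l" by (rule ix_exhaust)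
    have "Suc k \<le> Suc l" using that k l by (simp add: ix_le_iff)
    then have "ext \<alpha> (Suc l) \<le> ext \<alpha> (Suc k)" using lift_Suc_antimono_le[of "ext \<alpha>"] s by blast
    then show ?thesis using k l by (simp add: ext_def)
  qed
  show "\<alpha> \<in> \<Gamma>"
    using a[rule_format, of 0] a[rule_format, of "CARD('n)"] anti
    by (simp add: \<Gamma>_def bary_0 bary_last)
qed

lemma Gammao_iff: "\<alpha> \<in> \<Gamma>o \<longleftrightarrow> \<alpha> \<in> \<Gamma> \<and> 0 < bary \<alpha> 0"
  by (simp add: \<Gamma>o_def bary_0)

lemma bary_nonneg:
  "\<alpha> \<in> \<Gamma> \<Longrightarrow> k \<le> CARD('n) \<Longrightarrow> 0 \<le> bary (\<alpha> :: real ^ 'n::{finite,wellorder}) k"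
  by (simp add: Gamma_iff)

lemma piece_iff:
  fixes \<alpha> :: "real ^ 'n::{finite,wellorder}"
  shows "\<alpha> $ first_ix + \<alpha> $ last_ix \<le> 1 \<longleftrightarrow> bary \<alpha> CARD('n) \<le> bary \<alpha> 0"
    and "\<alpha> $ first_ix + \<alpha> $ last_ix \<ge> 1 \<longleftrightarrow> bary \<alpha> 0 \<le> bary \<alpha> CARD('n)"
  by (auto simp: bary_0 bary_last)

lemma exists_bary:
  assumes "(\<Sum>j\<le>CARD('n). b j) = 1"
  obtains \<alpha> :: "real ^ 'n::{finite,wellorder}" where "\<And>k. k \<le> CARD('n) \<Longrightarrow> bary \<alpha> k = b k"
proof -
  \<comment> \<open>Differencing is inverted by summing: alpha_(k+1), stored at \<open>ix k\<close>,
    has to be the tail sum of \<open>b\<close> from k + 1 on.\<close>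
  define \<alpha> :: "real ^ 'n::{finite,wellorder}" where
    "\<alpha> = (\<chi> i. \<Sum>j = Suc (inv_into {..<CARD('n)} ix i)..CARD('n). b j)"
  have inv: "inv_into {..<CARD('n)} (ix :: nat \<Rightarrow> 'n) (ix k) = k" if "k < CARD('n)" for k
    using ix_bij[where 'n='n] that by (simp add: bij_betw_def inv_into_f_f)
  have e: "ext \<alpha> k = (\<Sum>j=k..CARD('n). b j)" if "k \<le> Suc CARD('n)" for k
  proof (cases "k = 0 \<or> k = Suc CARD('n)")
    case True
    then show ?thesis using assms by (auto simp: ext_gt atMost_atLeast0)
  next
    case False
    with that have "k - 1 < CARD('n)" by auto
    with False that inv[of "k - 1"] show ?thesis by (simp add: ext_def \<alpha>_def)
  qed
  have "bary \<alpha> k = b k" if "k \<le> CARD('n)" for k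
    using that by (simp add: bary_def e sum.atLeast_Suc_atMost)
  then show thesis using that by blast
qed

section \<open>The tent map in barycentric coordinates\<close>

lemma ext_tent:
  fixes \<alpha> :: "real ^ 'n::{finite,wellorder}"
  assumes "1 \<le> k" "k < CARD('n)"
  shows "ext (tent \<alpha>) (Suc k) = ext \<alpha> k - \<alpha> $ last_ix"
proof -
  obtain j where j: "k = Suc j" using assms by (cases k) auto
  have "(ix k :: 'n) \<noteq> first_ix"
    using assms ix_less_iff[of 0 k, where 'n='n] by (simp add: first_ix_eq)
  with assms j show ?thesis by (simp add: ext_def tent_def prev_ix_Suc)
qed

text \<open>With the next two lemmas: (b_0, ..., b_n) goes to (|b_0 - b_n|, 2 min(b_0, b_n), b_1,
  ..., b_(n-1)), and the larger of b_0 and b_n decides the half.\<close>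

lemma bary_tent_0:
  fixes \<alpha> :: "real ^ 'n::{finite,wellorder}"
  shows "bary (tent \<alpha>) 0 = \<bar>bary \<alpha> 0 - bary \<alpha> CARD('n)\<bar>"
  by (auto simp: bary_0 bary_last tent_def)

lemma bary_tent_1:
  fixes \<alpha> :: "real ^ 'n::{finite,wellorder}"
  shows "bary (tent \<alpha>) (Suc 0) = 2 * min (bary \<alpha> 0) (bary \<alpha> CARD('n))"
\<comment> \<open>For n = 1 coordinate 1 is also the last one, so the entry subtracted in it is the
  padding 0 and \<open>ext_tent\<close> has no admissible index.\<close>
proof (cases "CARD('n) = 1")
  case True
  then have "(first_ix :: 'n) = last_ix" by (simp add: first_ix_eq last_ix_eq)
  then have "bary (tent \<alpha>) (Suc 0) = tent \<alpha> $ first_ix"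
    using bary_last[of "tent \<alpha>"] True by simp
  with \<open>(first_ix :: 'n) = last_ix\<close> show ?thesis
    by (auto simp: bary_0 bary_last tent_def)
next
  case False
  then have "1 < CARD('n)" using zero_less_card_finite[where 'a='n] by linarith
  then have "bary (tent \<alpha>) (Suc 0) = tent \<alpha> $ first_ix - (\<alpha> $ first_ix - \<alpha> $ last_ix)"
    using ext_tent[of 1 \<alpha>] by (simp add: bary_def ext_first)
  then show ?thesis by (auto simp: bary_0 bary_last tent_def)
qed

lemma bary_tent_Suc:
  fixes \<alpha> :: "real ^ 'n::{finite,wellorder}"
  assumes "1 \<le> k" "k < CARD('n)"
  shows "bary (tent \<alpha>) (Suc k) = bary \<alpha> k"
proof (cases "Suc k = CARD('n)")
  case True
  then show ?thesis
    using ext_tent[OF assms, of \<alpha>] bary_last[of "tent \<alpha>"] ext_last[of \<alpha>]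
    by (simp add: bary_def ext_gt)
next
  case False
  with assms have "Suc k < CARD('n)" by simp
  then show ?thesis using ext_tent[OF assms, of \<alpha>] ext_tent[of "Suc k" \<alpha>]
    by (simp add: bary_def)
qed

lemma tent_Gamma:
  fixes \<alpha> :: "real ^ 'n::{finite,wellorder}"
  assumes "\<alpha> \<in> \<Gamma>"
  shows "tent \<alpha> \<in> \<Gamma>"
  unfolding Gamma_iff
proof (intro allI impI)
  fix k assume k: "k \<le> CARD('n)"
  consider "k = 0" | "k = Suc 0" | j where "k = Suc j" "1 \<le> j" "j < CARD('n)"
    using k by (metis One_nat_def Suc_le_eq Suc_le_lessD le_0_eq not_less_eq_eq old.nat.exhaust)
  then show "0 \<le> bary (tent \<alpha>) k"
    using bary_nonneg[OF assms] by cases (auto simp: bary_tent_0 bary_tent_1 bary_tent_Suc)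
qed

section \<open>The inverse branches\<close>

definition branch :: "bool \<Rightarrow> real ^ 'n::{finite,wellorder} \<Rightarrow> real ^ 'n::{finite,wellorder}" where
  "branch c = (if c then \<tau>\<^sub>1 else \<tau>\<^sub>0)"

definition bpiece :: "bool \<Rightarrow> (real ^ 'n::{finite,wellorder}) set" where
  "bpiece c = {\<alpha> \<in> \<Gamma>. if c then bary \<alpha> 0 \<le> bary \<alpha> CARD('n) else bary \<alpha> CARD('n) \<le> bary \<alpha> 0}"

lemma branch_eq: "branch c = inv_into (bpiece c) tent"
  by (simp add: branch_def bpiece_def \<tau>\<^sub>0_def \<tau>\<^sub>1_def piece_iff)

text \<open>The action of \<open>branch c\<close> on coordinates: b_1 is split in halves between the
  first and the last place, \<open>c\<close> decides which of these also receives b_0, and the rest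
  moves one place to the left. The argument is an arbitrary sequence, so that absolute differences
  of coordinates can be inserted too.\<close>

definition bstep :: "bool \<Rightarrow> nat \<Rightarrow> (nat \<Rightarrow> real) \<Rightarrow> nat \<Rightarrow> real" where
  "bstep c n b k =
    (if k = 0 then (if c then b 1 / 2 else b 0 + b 1 / 2)
     else if k = n then (if c then b 0 + b 1 / 2 else b 1 / 2)
     else b (Suc k))"

text \<open>On one half the sign of b_0 - b_n is known, so |b_0 - b_n| and 2 min(b_0, b_n) determine
  b_n; the coordinates in between are only shifted.\<close>

lemma inj_on_tent: "inj_on tent (bpiece c :: (real ^ 'n::{finite,wellorder}) set)"
proof (rule inj_onI)
  fix x y :: "real ^ 'n::{finite,wellorder}"
  assume x: "x \<in> bpiece c" and y: "y \<in> bpiece c" and e: "tent x = tent y"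
  have n: "bary x CARD('n) = bary y CARD('n)"
    using bary_tent_0[of x] bary_tent_0[of y] bary_tent_1[of x] bary_tent_1[of y] x y
    unfolding e by (auto simp: bpiece_def split: if_splits)
  show "x = y"
  proof (rule bary_inject)
    fix k assume "1 \<le> k" "k \<le> CARD('n)"
    then show "bary x k = bary y k"
      using n bary_tent_Suc[of k x] bary_tent_Suc[of k y] e by (cases "k = CARD('n)") auto
  qed
qed

lemma sum_bstep:
  assumes "1 \<le> n"
  shows "(\<Sum>j\<le>n. bstep c n b j) = (\<Sum>j\<le>n. b j)"
proof -
  obtain m where m: "n = Suc m" using assms by (cases n) auto
  have "(\<Sum>j\<le>n. bstep c n b j)
      = bstep c n b 0 + (\<Sum>j<m. bstep c n b (Suc j)) + bstep c n b n"
    using m by (simp add: sum.atMost_shift)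
  also have "(\<Sum>j<m. bstep c n b (Suc j)) = (\<Sum>j<m. b (Suc (Suc j)))"
    using m by (intro sum.cong) (auto simp: bstep_def)
  also have "bstep c n b 0 + \<dots> + bstep c n b n = b 0 + b 1 + (\<Sum>j<m. b (Suc (Suc j)))"
    using m by (simp add: bstep_def)
  also have "\<dots> = (\<Sum>j\<le>n. b j)"
    using m by (simp add: sum.atMost_shift sum.lessThan_Suc_shift del: sum.lessThan_Suc sum.atMost_Suc)
  finally show ?thesis .
qed

lemma exists_branch:
  fixes y :: "real ^ 'n::{finite,wellorder}"
  assumes "y \<in> \<Gamma>"
  obtains x where "x \<in> bpiece c" "tent x = y"
    "\<And>k. k \<le> CARD('n) \<Longrightarrow> bary x k = bstep c CARD('n) (bary y) k"
proof -
  have n1: "1 \<le> CARD('n)" using zero_less_card_finite[where 'a='n] by linarith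
  obtain x :: "real ^ 'n::{finite,wellorder}"
    where x: "\<And>k. k \<le> CARD('n) \<Longrightarrow> bary x k = bstep c CARD('n) (bary y) k"
    using exists_bary[of "bstep c CARD('n) (bary y)"] sum_bstep[OF n1, of c "bary y"]
    by (auto simp: sum_bary)
  note nn = bary_nonneg[OF assms]
  have "x \<in> \<Gamma>"
    unfolding Gamma_iff using nn n1 nn[of 0] nn[of 1] by (auto simp: x bstep_def)
  then have p: "x \<in> bpiece c"
    using nn[of 0] nn[of 1] n1 by (auto simp: bpiece_def x bstep_def)
  have "tent x = y"
  proof (rule bary_inject)
    fix k assume k: "1 \<le> k" "k \<le> CARD('n)"
    show "bary (tent x) k = bary y k"
    proof (cases "k = 1")
      case True
      then show ?thesis
        using nn[of 0] nn[of 1] n1 by (auto simp: bary_tent_1 x bstep_def)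
    next
      case False
      then obtain j where "k = Suc j" "1 \<le> j" "j < CARD('n)" using k by (cases k) auto
      then show ?thesis by (simp add: bary_tent_Suc x bstep_def)
    qed
  qed
  with p x that show thesis by blast
qed

lemma
  fixes y :: "real ^ 'n::{finite,wellorder}"
  assumes "y \<in> \<Gamma>"
  shows branch_piece: "branch c y \<in> bpiece c"
    and tent_branch: "tent (branch c y) = y"
    and bary_branch: "k \<le> CARD('n) \<Longrightarrow> bary (branch c y) k = bstep c CARD('n) (bary y) k"
proof -
  obtain x where x: "x \<in> bpiece c" "tent x = y"
    "\<And>k. k \<le> CARD('n) \<Longrightarrow> bary x k = bstep c CARD('n) (bary y) k"
    using exists_branch[OF assms] by blast
  then have "branch c y = x"
    unfolding branch_eq using inv_into_f_f[OF inj_on_tent] by blast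
  with x show "branch c y \<in> bpiece c" "tent (branch c y) = y"
    "k \<le> CARD('n) \<Longrightarrow> bary (branch c y) k = bstep c CARD('n) (bary y) k"
    by auto
qed

lemma bpiece_Gamma: "x \<in> bpiece c \<Longrightarrow> x \<in> \<Gamma>"
  by (simp add: bpiece_def)

lemma branch_Gamma: "y \<in> \<Gamma> \<Longrightarrow> branch c y \<in> \<Gamma>"
  using branch_piece bpiece_Gamma by blast

lemma branch_tent: "x \<in> bpiece c \<Longrightarrow> branch c (tent x) = x"
  unfolding branch_eq by (rule inv_into_f_f[OF inj_on_tent])

lemma inj_on_branch: "inj_on (branch c) \<Gamma>"
  by (metis inj_onI tent_branch)

lemma bpiece_Un: "bpiece False \<union> bpiece True = \<Gamma>"
  by (auto simp: bpiece_def)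

section \<open>The odometer K\<close>

lemma tent_funpow_Gamma: "p \<in> \<Gamma> \<Longrightarrow> (tent ^^ j) p \<in> \<Gamma>"
  by (induction j) (auto intro: tent_Gamma)

lemma branch_funpow_Gamma: "p \<in> \<Gamma> \<Longrightarrow> (branch c ^^ j) p \<in> \<Gamma>"
  by (induction j) (auto intro: branch_Gamma)

lemma bary_le_1:
  fixes \<alpha> :: "real ^ 'n::{finite,wellorder}"
  assumes "\<alpha> \<in> \<Gamma>" "k \<le> CARD('n)"
  shows "bary \<alpha> k \<le> 1"
proof -
  have "bary \<alpha> k \<le> (\<Sum>j\<le>CARD('n). bary \<alpha> j)"
    by (rule member_le_sum) (use assms bary_nonneg in auto)
  then show ?thesis by (simp add: sum_bary)
qed

text \<open>A Lyapunov argument: the form \<open>2 e\<^sub>0\<^sup>2 + e\<^sub>1\<^sup>2 + \<dots> + e\<^sub>n\<^sup>2\<close> grows along the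
  orbit by the square of the increment of \<open>e\<^sub>0\<close>, so boundedness makes \<open>e\<^sub>0\<close> asymptotically
  constant, and the sum condition forces the constant to be \<open>0\<close>.\<close>

lemma bounded_stay_zero:
  fixes e :: "nat \<Rightarrow> nat \<Rightarrow> real"
  assumes e0: "\<And>j. e (Suc j) 0 = e j n - e j 0"
    and e1: "\<And>j. e (Suc j) (Suc 0) = 2 * e j 0"
    and eS: "\<And>j k. 1 \<le> k \<Longrightarrow> k < n \<Longrightarrow> e (Suc j) (Suc k) = e j k"
    and sum0: "\<And>j. (\<Sum>k\<le>n. e j k) = 0"
    and bd: "\<And>j k. k \<le> n \<Longrightarrow> \<bar>e j k\<bar> \<le> 1"
    and n: "1 \<le> n" and k: "1 \<le> k" "k \<le> n"
  shows "e 0 k = 0"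
proof -
  obtain m where m: "n = Suc m" using n by (cases n) auto
  define x where "x j = e j 0" for j
  define E where "E j = 2 * (x j)\<^sup>2 + (\<Sum>k<n. (e j (Suc k))\<^sup>2)" for j
  \<comment> \<open>The weight 2 on the square of \<open>x j\<close> makes the increment a perfect
    square: 6 e_0^2 - 4 e_0 e_n + e_n^2 = 2 e_0^2 + (e_n - 2 e_0)^2.\<close>
  have E_step: "E (Suc j) = E j + (x (Suc j) - x j)\<^sup>2" for j
  proof -
    have "(\<Sum>k<n. (e (Suc j) (Suc k))\<^sup>2) = (2 * e j 0)\<^sup>2 + (\<Sum>k<m. (e (Suc j) (Suc (Suc k)))\<^sup>2)"
      by (simp add: m e1 sum.lessThan_Suc_shift del: sum.lessThan_Suc)
    also have "(\<Sum>k<m. (e (Suc j) (Suc (Suc k)))\<^sup>2) = (\<Sum>k<m. (e j (Suc k))\<^sup>2)"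
      by (intro sum.cong) (auto simp: eS m)
    also have "\<dots> = (\<Sum>k<n. (e j (Suc k))\<^sup>2) - (e j n)\<^sup>2"
      by (simp add: m)
    finally show ?thesis
      by (simp add: E_def x_def e0 power2_eq_square algebra_simps)
  qed
  have "E j \<le> 2 + real n" for j
  proof -
    have sq: "(e j k)\<^sup>2 \<le> 1" if "k \<le> n" for k using bd[OF that] by (simp add: abs_square_le_1)
    have "(\<Sum>k<n. (e j (Suc k))\<^sup>2) \<le> (\<Sum>k<n. 1)" by (intro sum_mono) (auto intro: sq)
    with sq[of 0] show ?thesis by (simp add: E_def x_def)
  qed
  moreover have inc: "incseq E" by (rule incseq_SucI) (simp add: E_step)
  ultimately obtain L where L: "E \<longlonglongrightarrow> L"
    using incseq_convergent[of E "2 + real n"] by blast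
  have "(\<lambda>j. E (Suc j) - E j) \<longlonglongrightarrow> L - L" by (intro tendsto_diff LIMSEQ_Suc L)
  then have "(\<lambda>j. (x (Suc j) - x j)\<^sup>2) \<longlonglongrightarrow> 0" by (simp add: E_step)
  then have d: "(\<lambda>j. x (Suc j) - x j) \<longlonglongrightarrow> 0"
    using tendsto_real_sqrt by (force simp: tendsto_rabs_zero_iff)
  have di: "(\<lambda>j. x (j + i) - x j) \<longlonglongrightarrow> 0" for i
  proof (induction i)
    case (Suc i)
    have "(\<lambda>j. (x (Suc (j + i)) - x (j + i)) + (x (j + i) - x j)) \<longlonglongrightarrow> 0 + 0"
      using LIMSEQ_ignore_initial_segment[OF d, of i] Suc by (intro tendsto_add) auto
    then show ?case by simp
  qed simp
  \<comment> \<open>The entry in place k was created k steps earlier as twice a value of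
    \<open>x\<close> and has only been shifted since. The state at time j + n thus consists of n + 1
    consecutive values of \<open>x\<close>.\<close>
  have ex: "e (j + k) k = 2 * x j" if "1 \<le> k" "k \<le> n" for j k
    using that
  proof (induction k)
    case (Suc k)
    then show ?case by (cases "k = 0") (auto simp: e1 x_def eS)
  qed simp
  have ex': "e (j + n) (Suc k) = 2 * x (j + (n - Suc k))" if "k < n" for j k
    using ex[of "Suc k" "j + (n - Suc k)"] that by simp
  \<comment> \<open>Nearby values of \<open>x\<close> agree asymptotically, so this vanishing sum is
    (1 + 2n) \<open>x j\<close> up to a null sequence; hence \<open>x\<close> tends to 0.\<close>
  have s: "x (j + n) + (\<Sum>k<n. 2 * x (j + (n - Suc k))) = 0" for j
    using sum0[of "j + n"] ex' by (simp add: sum.atMost_shift x_def)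
  have "(\<lambda>j. (x (j + n) - x j) + (\<Sum>k<n. 2 * (x (j + (n - Suc k)) - x j))) \<longlonglongrightarrow> 0 + (\<Sum>k<n. 2 * 0)"
    by (intro tendsto_add tendsto_sum tendsto_mult di tendsto_const)
  moreover have "(x (j + n) - x j) + (\<Sum>k<n. 2 * (x (j + (n - Suc k)) - x j)) = - (1 + 2 * real n) * x j" for j
    using s[of j] by (simp add: right_diff_distrib sum_subtractf algebra_simps)
  ultimately have "(\<lambda>j. - (1 + 2 * real n) * x j) \<longlonglongrightarrow> 0" by simp
  then have "(\<lambda>j. (- (1 + 2 * real n) * x j) * (- 1 / (1 + 2 * real n))) \<longlonglongrightarrow> 0 * (- 1 / (1 + 2 * real n))"
    by (rule tendsto_mult_right)
  moreover have "(- (1 + 2 * real n) * x j) * (- 1 / (1 + 2 * real n)) = x j" for j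
  proof -
    have "1 + 2 * real n \<noteq> 0" by linarith
    then show ?thesis by (simp add: field_simps)
  qed
  ultimately have x0: "x \<longlonglongrightarrow> 0" by simp
  \<comment> \<open>\<open>E\<close>, now expressed through values of \<open>x\<close> alone, tends
    to 0. Being increasing and nonnegative, it is 0 from the start.\<close>
  have "(\<lambda>j. 2 * (x (j + n))\<^sup>2 + (\<Sum>k<n. (2 * x (j + (n - Suc k)))\<^sup>2)) \<longlonglongrightarrow> 2 * 0\<^sup>2 + (\<Sum>k<n. (2 * 0)\<^sup>2)"
    by (intro tendsto_intros LIMSEQ_ignore_initial_segment x0)
  then have "(\<lambda>j. E (j + n)) \<longlonglongrightarrow> 0" by (simp add: E_def ex')
  then have "L = 0"
    using LIMSEQ_ignore_initial_segment[OF L, of n] LIMSEQ_unique by blast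
  then have "E 0 \<le> 0" using incseq_le[OF inc L] by simp
  then have "(\<Sum>k<n. (e 0 (Suc k))\<^sup>2) \<le> 0" by (simp add: E_def) (smt (verit) zero_le_power2)
  then have "(\<Sum>k<n. (e 0 (Suc k))\<^sup>2) = 0" by (intro antisym sum_nonneg) auto
  then have "\<forall>k<n. e 0 (Suc k) = 0" by (simp add: sum_nonneg_eq_0_iff)
  then show ?thesis using k by (cases k) auto
qed

text \<open>On the half of \<open>branch True\<close> the tent map is affine, so the coordinate
  differences of two orbits that never leave it obey the recurrence of
  \<open>bounded_stay_zero\<close>. This yields both the uniqueness of the fixed point and the
  escape of every other point.\<close>

lemma stay_unique:
  fixes p q :: "real ^ 'n::{finite,wellorder}"
  assumes p: "\<And>j. (tent ^^ j) p \<in> bpiece True" and q: "\<And>j. (tent ^^ j) q \<in> bpiece True"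
  shows "p = q"
proof (rule bary_inject)
  fix k assume k: "1 \<le> k" "k \<le> CARD('n)"
  let ?e = "\<lambda>j k. bary ((tent ^^ j) p) k - bary ((tent ^^ j) q) k"
  have G: "(tent ^^ j) p \<in> \<Gamma>" "(tent ^^ j) q \<in> \<Gamma>" for j
    using p q bpiece_Gamma by blast+
  have m: "bary ((tent ^^ j) p) 0 \<le> bary ((tent ^^ j) p) CARD('n)"
    "bary ((tent ^^ j) q) 0 \<le> bary ((tent ^^ j) q) CARD('n)" for j
    using p[of j] q[of j] by (auto simp: bpiece_def)
  have "?e 0 k = 0"
  proof (rule bounded_stay_zero[of ?e "CARD('n)", OF _ _ _ _ _ _ k])
    show "\<bar>?e j k\<bar> \<le> 1" if "k \<le> CARD('n)" for j k
      using bary_nonneg[OF G(1) that, of j] bary_nonneg[OF G(2) that, of j]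
        bary_le_1[OF G(1) that, of j] bary_le_1[OF G(2) that, of j] by linarith
  qed (use m in \<open>auto simp: bary_tent_0 bary_tent_1 bary_tent_Suc sum_subtractf sum_bary Suc_le_eq\<close>)
  then show "bary p k = bary q k" by simp
qed

lemma exists_fixed: "\<exists>v :: real ^ 'n::{finite,wellorder}. v \<in> \<Gamma> \<and> branch True v = v"
proof -
  let ?n = "CARD('n)"
  \<comment> \<open>Being fixed by \<open>branch True\<close> forces b_1 = ... = b_n = 2 b_0, and
    the sum 1 then gives b_0 = 1 / (2n + 1).\<close>
  define d where "d = 1 / (2 * real CARD('n) + 1)"
  have pos: "0 < d" by (simp add: d_def)
  have "(\<Sum>j\<le>?n. if j = 0 then d else 2 * d) = d + real ?n * (2 * d)"
    by (simp add: sum.atMost_shift)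
  also have "\<dots> = 1" by (simp add: d_def field_simps)
  finally obtain v :: "real ^ 'n::{finite,wellorder}"
    where v: "\<And>k. k \<le> ?n \<Longrightarrow> bary v k = (if k = 0 then d else 2 * d)"
    using exists_bary by blast
  have G: "v \<in> \<Gamma>" using pos by (auto simp: Gamma_iff v)
  have "branch True v = v"
    by (rule bary_inject) (auto simp: bary_branch[OF G] v bstep_def)
  with G show ?thesis by blast
qed

lemma fixed_stays:
  assumes "v \<in> \<Gamma>" "branch True v = v"
  shows "tent v = v" "(tent ^^ j) v \<in> bpiece True"
proof -
  show t: "tent v = v" using tent_branch[OF assms(1), of True] assms(2) by simp
  have "(tent ^^ j) v = v" by (induction j) (auto simp: t)
  then show "(tent ^^ j) v \<in> bpiece True" using branch_piece[OF assms(1), of True] assms(2) by simp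
qed

lemma v_minus1_eq:
  fixes v :: "real ^ 'n::{finite,wellorder}"
  assumes "\<And>j. (tent ^^ j) v \<in> bpiece True"
  shows "v = v_minus1"
proof -
  obtain w :: "real ^ 'n::{finite,wellorder}" where w: "w \<in> \<Gamma>" "branch True w = w"
    using exists_fixed by blast
  have "v_minus1 = w"
    unfolding v_minus1_def
  proof (rule the_equality)
    show "w \<in> \<Gamma> \<and> \<tau>\<^sub>1 w = w" using w by (simp add: branch_def)
    show "u = w" if "u \<in> \<Gamma> \<and> \<tau>\<^sub>1 u = u" for u
      using stay_unique[OF fixed_stays(2) fixed_stays(2), of u w] that w by (simp add: branch_def)
  qed
  moreover have "v = w" by (rule stay_unique[OF assms fixed_stays(2)[OF w]])
  ultimately show ?thesis by simp
qed

lemma v_minus1: "v_minus1 \<in> \<Gamma>" "branch True v_minus1 = v_minus1"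
proof -
  obtain w :: "real ^ 'n::{finite,wellorder}" where w: "w \<in> \<Gamma>" "branch True w = w"
    using exists_fixed by blast
  then have "w = v_minus1" using v_minus1_eq fixed_stays(2) by blast
  with w show "(v_minus1 :: real ^ 'n::{finite,wellorder}) \<in> \<Gamma>"
    "branch True v_minus1 = (v_minus1 :: real ^ 'n::{finite,wellorder})" by auto
qed

lemma one_le_card: "1 \<le> CARD('n::finite)"
  using zero_less_card_finite[where 'a='n] by linarith

text \<open>For b_0 > 0 the image has first coordinate b_0 + b_1/2, strictly above its last
  coordinate b_1/2. Building the cylinders on \<open>\<Gamma>o\<close> thus keeps them disjoint, as
  the branches agree over the face b_0 = 0.\<close>

lemma branch_False_outside:
  assumes "r \<in> \<Gamma>o"
  shows "branch False r \<notin> bpiece True"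
proof -
  have "r \<in> \<Gamma>" "0 < bary r 0" using assms by (auto simp: Gammao_iff)
  then show ?thesis
    using one_le_card[where 'n='a] by (auto simp: bpiece_def bary_branch bstep_def)
qed

lemma cylinder_exists:
  assumes "p \<in> \<Gamma>" "p \<noteq> v_minus1"
  obtains k r where "r \<in> \<Gamma>o" "p = (branch True ^^ k) (branch False r)"
proof -
  obtain j where j: "(tent ^^ j) p \<notin> bpiece True" using v_minus1_eq assms(2) by blast
  \<comment> \<open>The first time the orbit is outside the half of \<open>branch True\<close>; up
    to then \<open>branch True\<close> retraces the orbit backwards.\<close>
  define k where "k = (LEAST j. (tent ^^ j) p \<notin> bpiece True)"
  have k: "(tent ^^ k) p \<notin> bpiece True" unfolding k_def using j by (rule LeastI)
  have l: "(tent ^^ i) p \<in> bpiece True" if "i < k" for i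
    using not_less_Least that unfolding k_def by blast
  have "p = (branch True ^^ i) ((tent ^^ i) p)" if "i \<le> k" for i
    using that
  proof (induction i)
    case (Suc i)
    then have "branch True (tent ((tent ^^ i) p)) = (tent ^^ i) p" by (intro branch_tent l) simp
    with Suc show ?case by (simp add: funpow_swap1)
  qed simp
  then have p: "p = (branch True ^^ k) ((tent ^^ k) p)" by simp
  let ?q = "(tent ^^ k) p"
  have q: "?q \<in> \<Gamma>" using assms tent_funpow_Gamma by blast
  \<comment> \<open>Outside that half b_n < b_0 holds strictly, which makes coordinate 0 of the tent
    image positive.\<close>
  with k have "?q \<in> bpiece False" "bary (tent ?q) 0 > 0" by (auto simp: bpiece_def bary_tent_0)
  then have "tent ?q \<in> \<Gamma>o" "?q = branch False (tent ?q)"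
    using tent_Gamma[OF q] by (simp_all add: Gammao_iff branch_tent)
  with p that show thesis by metis
qed

text \<open>Common outer factors \<open>branch True\<close> cancel by injectivity. If one side runs
  out of them first, \<open>branch False r\<close> or \<open>branch False s\<close> would lie in the
  half of \<open>branch True\<close>, against \<open>branch_False_outside\<close>.\<close>

lemma cylinder_unique:
  assumes r: "r \<in> \<Gamma>o" and s: "s \<in> \<Gamma>o"
    and "(branch True ^^ k) (branch False r) = (branch True ^^ l) (branch False s)"
  shows "k = l \<and> r = s"
  using assms(3)
proof (induction k arbitrary: l)
  case 0
  have G: "r \<in> \<Gamma>" "s \<in> \<Gamma>" using r s by (auto simp: Gammao_iff)
  show ?case
  proof (cases l)
    case 0
    with \<open>(branch True ^^ 0) _ = _\<close> G show ?thesis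
      using inj_onD[OF inj_on_branch] by force
  next
    case (Suc m)
    have "branch True ((branch True ^^ m) (branch False s)) \<in> bpiece True"
      by (intro branch_piece branch_funpow_Gamma branch_Gamma G)
    with 0 Suc branch_False_outside[OF r] show ?thesis by simp
  qed
next
  case (Suc k)
  have G: "r \<in> \<Gamma>" "s \<in> \<Gamma>" using r s by (auto simp: Gammao_iff)
  note GG = branch_funpow_Gamma[OF branch_Gamma]
  show ?case
  proof (cases l)
    case 0
    have "branch True ((branch True ^^ k) (branch False r)) \<in> bpiece True"
      by (intro branch_piece GG G)
    with 0 Suc.prems branch_False_outside[OF s] show ?thesis by simp
  next
    case (Suc m)
    with Suc.prems have "branch True ((branch True ^^ k) (branch False r)) =
        branch True ((branch True ^^ m) (branch False s))" by simp
    then have "(branch True ^^ k) (branch False r) = (branch True ^^ m) (branch False s)"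
      using inj_onD[OF inj_on_branch _ GG GG] G by blast
    with Suc.IH[of m] Suc show ?thesis by simp
  qed
qed

lemma cylinder_neq_v_minus1:
  assumes r: "r \<in> \<Gamma>o"
  shows "(branch True ^^ k) (branch False r) \<noteq> v_minus1"
proof (induction k)
  case 0
  then show ?case using branch_False_outside[OF r] branch_piece[OF v_minus1(1), of True]
    by (auto simp: v_minus1(2))
next
  case (Suc k)
  have "(branch True ^^ k) (branch False r) \<in> \<Gamma>"
    using r by (intro branch_funpow_Gamma branch_Gamma) (simp add: Gammao_iff)
  then have "branch True ((branch True ^^ k) (branch False r)) \<noteq> branch True v_minus1"
    using Suc inj_onD[OF inj_on_branch _ _ v_minus1(1)] by blast
  then show ?case by (simp add: v_minus1(2))
qed

lemma Kmap_cylinder: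
  fixes r :: "real ^ 'n::{finite,wellorder}"
  assumes r: "r \<in> \<Gamma>o"
  shows "Kmap ((branch True ^^ k) (branch False r)) = (branch False ^^ k) (branch True r)"
proof -
  let ?p = "(branch True ^^ k) (branch False r)"
  have "(THE l. ?p \<in> ((branch True ^^ l) \<circ> branch False) ` \<Gamma>o) = k"
  proof (rule the_equality)
    show "?p \<in> ((branch True ^^ k) \<circ> branch False) ` \<Gamma>o" using r by auto
    show "l = k" if "?p \<in> ((branch True ^^ l) \<circ> branch False) ` \<Gamma>o" for l
      using that cylinder_unique[OF r, of _ k l] by auto
  qed
  moreover have "inv_into \<Gamma>o ((branch True ^^ k) \<circ> branch False) ?p = r"
  proof -
    have "inj_on ((branch True ^^ k) \<circ> branch False) \<Gamma>o"
      using cylinder_unique by (auto simp: inj_on_def)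
    then show ?thesis using inv_into_f_f[OF _ r] by fastforce
  qed
  moreover have "\<tau>\<^sub>0 = (branch False :: _ \<Rightarrow> real ^ 'n::{finite,wellorder})" "\<tau>\<^sub>1 = (branch True :: _ \<Rightarrow> real ^ 'n::{finite,wellorder})"
    by (simp_all add: branch_def)
  ultimately show ?thesis
    using cylinder_neq_v_minus1[OF r] by (simp add: Kmap_def Let_def)
qed

lemma Kmap_branch_False: "r \<in> \<Gamma>o \<Longrightarrow> Kmap (branch False r) = branch True r"
  using Kmap_cylinder[of r 0] by simp

lemma zero_Gamma: "0 \<in> \<Gamma>"
  by (simp add: \<Gamma>_def)

lemma bary_zero: "bary 0 k = (if k = 0 then 1 else 0)"
  by (simp add: bary_def ext_def)

lemma branch_False_zero: "branch False 0 = 0"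
  by (rule bary_inject) (auto simp: bary_branch[OF zero_Gamma] bstep_def bary_zero)

text \<open>One more outer \<open>branch True\<close> raises k by one and so puts one more
  \<open>branch False\<close> on the image: the carry of an adding machine. At
  \<open>v_minus1\<close> both sides are 0, because \<open>branch False\<close> fixes 0.\<close>

lemma Kmap_branch_True:
  fixes y :: "real ^ 'n::{finite,wellorder}"
  assumes "y \<in> \<Gamma>"
  shows "Kmap (branch True y) = branch False (Kmap y)"
proof (cases "y = v_minus1")
  case True
  have "Kmap y = 0" using True by (simp add: Kmap_def)
  then show ?thesis unfolding True v_minus1(2) by (simp add: branch_False_zero)
next
  case False
  then obtain k r where "r \<in> \<Gamma>o" "y = (branch True ^^ k) (branch False r)"
    using cylinder_exists assms by blast
  then show ?thesis using Kmap_cylinder[of r k] Kmap_cylinder[of r "Suc k"] by simp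
qed

lemma Kmap_Gamma:
  assumes "y \<in> \<Gamma>"
  shows "Kmap y \<in> \<Gamma>"
proof (cases "y = v_minus1")
  case True
  then show ?thesis by (simp add: Kmap_def zero_Gamma)
next
  case False
  then obtain k r where "r \<in> \<Gamma>o" "y = (branch True ^^ k) (branch False r)"
    using cylinder_exists assms by blast
  then show ?thesis
    using Kmap_cylinder[of r k] by (auto intro!: branch_funpow_Gamma branch_Gamma simp: Gammao_iff)
qed

lemma Kmap_funpow_Gamma: "p \<in> \<Gamma> \<Longrightarrow> (Kmap ^^ j) p \<in> \<Gamma>"
  by (induction j) (auto intro: Kmap_Gamma)

section \<open>Orbit sums and preimage sums\<close>

text \<open>Sums over the preimages of a point under the tent map. The two branches agree on the face
  \<open>bary y 0 = 0\<close>, where there is only one preimage; it is counted once.\<close>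

definition psum :: "(real ^ 'n::{finite,wellorder} \<Rightarrow> 'b::comm_monoid_add) \<Rightarrow> real ^ 'n::{finite,wellorder} \<Rightarrow> 'b" where
  "psum h y = (if 0 < bary y 0 then h (branch False y) else 0) + h (branch True y)"

text \<open>The value type is general because the same identities serve real test functions and step
  counts in \<open>nat\<close>.\<close>

definition birkhoff :: "(real ^ 'n::{finite,wellorder} \<Rightarrow> 'b::comm_monoid_add) \<Rightarrow> nat \<Rightarrow> real ^ 'n::{finite,wellorder} \<Rightarrow> 'b" where
  "birkhoff h N x = (\<Sum>i<N. h ((Kmap ^^ i) x))"

lemma birkhoff_add: "birkhoff h (M + N) x = birkhoff h M x + birkhoff h N ((Kmap ^^ M) x)"
proof (induction N)
  case (Suc N)
  have "(Kmap ^^ (M + N)) x = (Kmap ^^ N) ((Kmap ^^ M) x)"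
    by (simp add: add.commute[of M N] funpow_add)
  with Suc show ?case by (simp add: birkhoff_def add.assoc)
qed (simp add: birkhoff_def)

lemma branches_agree:
  fixes y :: "real ^ 'n::{finite,wellorder}"
  assumes "y \<in> \<Gamma>" "\<not> 0 < bary y 0"
  shows "branch False y = branch True y"
proof (rule bary_inject)
  have "bary y 0 = 0" using assms bary_nonneg[of y 0] by simp
  then show "bary (branch False y) k = bary (branch True y) k" if "1 \<le> k" "k \<le> CARD('n)" for k
    using that by (simp add: bary_branch assms bstep_def)
qed

text \<open>From \<open>branch False z\<close> the map K leads to \<open>branch True z\<close> and
  then to \<open>branch False (Kmap z)\<close>; if coordinate 0 of \<open>z\<close> vanishes, the
  first two points coincide and one step leads on. Each point of the orbit of \<open>y\<close> is
  thus replaced by its distinct preimages, and \<open>M N\<close> counts those of the first N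
  points.\<close>

lemma birkhoff_psum:
  fixes y :: "real ^ 'n::{finite,wellorder}" and h :: "real ^ 'n::{finite,wellorder} \<Rightarrow> 'b::comm_monoid_add"
  assumes y: "y \<in> \<Gamma>"
  defines "M \<equiv> \<lambda>N. birkhoff (psum (\<lambda>_. 1::nat)) N y"
  shows "birkhoff h (M N) (branch False y) = birkhoff (psum h) N y"
    and "(Kmap ^^ M N) (branch False y) = branch False ((Kmap ^^ N) y)"
proof -
  have "birkhoff h (M N) (branch False y) = birkhoff (psum h) N y \<and>
    (Kmap ^^ M N) (branch False y) = branch False ((Kmap ^^ N) y)"
  proof (induction N)
    case 0
    then show ?case by (simp add: M_def birkhoff_def)
  next
    case (Suc N)
    define z where "z = (Kmap ^^ N) y"
    have z: "z \<in> \<Gamma>" unfolding z_def using y by (rule Kmap_funpow_Gamma)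
    define l where "l = psum (\<lambda>_. 1::nat) z"
    have M: "M (Suc N) = M N + l" by (simp add: M_def l_def z_def birkhoff_def)
    have "birkhoff h l (branch False z) = psum h z \<and> (Kmap ^^ l) (branch False z) = branch False (Kmap z)"
    proof (cases "0 < bary z 0")
      case True
      then have l: "l = Suc (Suc 0)" by (simp add: l_def psum_def)
      have "Kmap (branch False z) = branch True z"
        using True z by (intro Kmap_branch_False) (simp add: Gammao_iff)
      then show ?thesis using True z
        by (simp add: birkhoff_def l psum_def Kmap_branch_True)
    next
      case False
      then have l: "l = Suc 0" by (simp add: l_def psum_def)
      show ?thesis using False branches_agree[OF z False] z
        by (simp add: birkhoff_def l psum_def Kmap_branch_True)
    qed
    moreover have "(Kmap ^^ (M N + l)) (branch False y) = (Kmap ^^ l) ((Kmap ^^ M N) (branch False y))"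
      by (simp add: add.commute[of "M N" l] funpow_add)
    moreover have "birkhoff (psum h) (Suc N) y = birkhoff (psum h) N y + psum h z"
      by (simp add: birkhoff_def z_def)
    ultimately show ?case
      using Suc by (simp add: M birkhoff_add z_def)
  qed
  then show "birkhoff h (M N) (branch False y) = birkhoff (psum h) N y"
    and "(Kmap ^^ M N) (branch False y) = branch False ((Kmap ^^ N) y)" by auto
qed

text \<open>The induction step needs the claim at two value types: at \<open>'b\<close> for the test
  function, and at \<open>nat\<close> to compute \<open>M (Suc m)\<close>. An induction hypothesis
  has fixed types, hence the conjunction.\<close>

lemma birkhoff_psum_iterate:
  fixes y :: "real ^ 'n::{finite,wellorder}" and h :: "real ^ 'n::{finite,wellorder} \<Rightarrow> 'b::comm_monoid_add"
    and g :: "real ^ 'n::{finite,wellorder} \<Rightarrow> nat" and N :: nat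
  assumes y: "y \<in> \<Gamma>"
  defines "M \<equiv> \<lambda>m. birkhoff ((psum ^^ m) (\<lambda>_. 1::nat)) N y"
  shows "birkhoff h (M m) ((branch False ^^ m) y) = birkhoff ((psum ^^ m) h) N y \<and>
    birkhoff g (M m) ((branch False ^^ m) y) = birkhoff ((psum ^^ m) g) N y"
proof (induction m arbitrary: h g)
  case 0
  then show ?case by (simp add: M_def birkhoff_def)
next
  case (Suc m)
  let ?z = "(branch False ^^ m) y"
  have z: "?z \<in> \<Gamma>" using y by (rule branch_funpow_Gamma)
  have M: "birkhoff (psum (\<lambda>_. 1::nat)) (M m) ?z = M (Suc m)"
    using Suc[of undefined "psum (\<lambda>_. 1)"] by (simp only: M_def funpow_Suc_right o_apply)
  have b: "(branch False ^^ Suc m) y = branch False ?z" by simp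
  show ?case
    unfolding b unfolding funpow_Suc_right o_apply
    using birkhoff_psum(1)[OF z, of h "M m"] birkhoff_psum(1)[OF z, of g "M m"] Suc[of "psum h" "psum g"] by (simp only: M simp_thms)
qed

text \<open>After at most one step the orbit is at some \<open>branch False y\<close>. The orbit of
  \<open>y\<close> reaches depth m by induction, and \<open>birkhoff_psum\<close> lifts that journey
  through \<open>branch False\<close>.\<close>

lemma reaches_base:
  assumes "x \<in> \<Gamma>"
  shows "\<exists>t. \<exists>y\<in>\<Gamma>. (Kmap ^^ t) x = (branch False ^^ m) y"
  using assms
proof (induction m arbitrary: x)
  case 0
  then show ?case by (intro exI[of _ 0]) auto
next
  case (Suc m)
  have "\<exists>t. \<exists>y\<in>\<Gamma>. (Kmap ^^ t) x = branch False y"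
  proof (cases "x \<in> bpiece True")
    case True
    then have "Kmap x = branch False (Kmap (tent x))"
      using Kmap_branch_True[of "tent x"] tent_Gamma[OF Suc.prems] by (simp add: branch_tent)
    then show ?thesis
      using tent_Gamma[OF Suc.prems] Kmap_Gamma by (intro exI[of _ 1]) auto
  next
    case False
    then have "x = branch False (tent x)" using bpiece_Un Suc.prems branch_tent by (metis UnE)
    then show ?thesis using tent_Gamma[OF Suc.prems] by (intro exI[of _ 0]) auto
  qed
  then obtain t y where y: "y \<in> \<Gamma>" "(Kmap ^^ t) x = branch False y" by blast
  obtain s z where z: "z \<in> \<Gamma>" "(Kmap ^^ s) y = (branch False ^^ m) z" using Suc.IH[OF y(1)] by blast
  let ?u = "birkhoff (psum (\<lambda>_. 1::nat)) s y"
  have "(Kmap ^^ (?u + t)) x = (branch False ^^ Suc m) z"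
    using birkhoff_psum(2)[OF y(1), of s] y(2) z(2) by (simp add: funpow_add)
  then show ?case using z(1) by blast
qed

section \<open>Continuity and compactness\<close>

lemma continuous_ext [continuous_intros]:
  "continuous_on S (\<lambda>\<alpha> :: real ^ 'n::{finite,wellorder}. ext \<alpha> k)"
  unfolding ext_def
  by (cases "k = 0"; cases "k \<le> CARD('n)") (auto intro!: continuous_intros)

lemma continuous_bary [continuous_intros]: "continuous_on S (\<lambda>\<alpha>. bary \<alpha> k)"
  unfolding bary_def by (intro continuous_intros)

lemma compact_Gamma: "compact (\<Gamma> :: (real ^ 'n::{finite,wellorder}) set)"
proof -
  have "bounded (\<Gamma> :: (real ^ 'n::{finite,wellorder}) set)"
  proof (rule boundedI)
    fix x :: "real ^ 'n::{finite,wellorder}"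
    assume x: "x \<in> \<Gamma>"
    have "\<bar>x $ i\<bar> \<le> 1" for i
    proof -
      have "first_ix \<le> i" "i \<le> last_ix" by (simp_all add: first_ix_def last_ix_def)
      then have "x $ i \<le> x $ first_ix" "x $ last_ix \<le> x $ i" using x unfolding \<Gamma>_def by blast+
      then show ?thesis using x by (simp add: \<Gamma>_def)
    qed
    then have "(\<Sum>i\<in>UNIV. \<bar>x $ i\<bar>) \<le> (\<Sum>i\<in>(UNIV :: 'n set). 1)" by (intro sum_mono)
    then show "norm x \<le> real CARD('n)" using norm_le_l1_cart[of x] by simp
  qed
  moreover have "closed (\<Gamma> :: (real ^ 'n::{finite,wellorder}) set)"
  proof -
    have "\<Gamma> = (\<Inter>k\<in>{..CARD('n)}. {\<alpha> :: real ^ 'n::{finite,wellorder}. 0 \<le> bary \<alpha> k})"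
      by (auto simp: Gamma_iff)
    also have "closed \<dots>" by (intro closed_INT ballI closed_Collect_le continuous_intros)
    finally show ?thesis .
  qed
  ultimately show ?thesis by (simp add: compact_eq_bounded_closed)
qed

lemma compact_bpiece: "compact (bpiece c :: (real ^ 'n::{finite,wellorder}) set)"
proof -
  have "bpiece c = \<Gamma> \<inter> {\<alpha> :: real ^ 'n::{finite,wellorder}.
      if c then bary \<alpha> 0 \<le> bary \<alpha> CARD('n) else bary \<alpha> CARD('n) \<le> bary \<alpha> 0}"
    by (auto simp: bpiece_def)
  moreover have "closed {\<alpha> :: real ^ 'n::{finite,wellorder}.
      if c then bary \<alpha> 0 \<le> bary \<alpha> CARD('n) else bary \<alpha> CARD('n) \<le> bary \<alpha> 0}"
    by (cases c) (auto intro!: closed_Collect_le continuous_intros)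
  ultimately show ?thesis by (simp only: compact_Int_closed[OF compact_Gamma])
qed

section \<open>The averaging operator\<close>

text \<open>Unlike in \<open>psum\<close>, preimages count with multiplicity here: where the two
  branches agree, the single preimage has weight 1.\<close>

definition avg :: "(real ^ 'n::{finite,wellorder} \<Rightarrow> real) \<Rightarrow> real ^ 'n::{finite,wellorder} \<Rightarrow> real" where
  "avg h y = (h (branch False y) + h (branch True y)) / 2"

definition bdist :: "real ^ 'n::{finite,wellorder} \<Rightarrow> real ^ 'n::{finite,wellorder} \<Rightarrow> real" where
  "bdist x y = (\<Sum>k\<le>CARD('n). \<bar>bary x k - bary y k\<bar>)"

lemma bdist_nonneg: "0 \<le> bdist x y"
  by (simp add: bdist_def sum_nonneg)

lemma bdist_le_2:
  fixes x y :: "real ^ 'n::{finite,wellorder}"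
  assumes "x \<in> \<Gamma>" "y \<in> \<Gamma>"
  shows "bdist x y \<le> 2"
proof -
  have "bdist x y \<le> (\<Sum>k\<le>CARD('n). bary x k + bary y k)"
    unfolding bdist_def
    by (rule sum_mono) (use assms bary_nonneg in \<open>smt (verit) atMost_iff\<close>)
  then show ?thesis by (simp add: sum.distrib sum_bary)
qed

text \<open>By the triangle inequality the new absolute differences are bounded by
  \<open>bstep\<close> of the old ones, and \<open>bstep\<close> preserves the sum.\<close>

lemma bdist_branch:
  fixes x y :: "real ^ 'n::{finite,wellorder}"
  assumes "x \<in> \<Gamma>" "y \<in> \<Gamma>"
  shows "bdist (branch c x) (branch c y) \<le> bdist x y"
proof -
  have "bdist (branch c x) (branch c y)
      \<le> (\<Sum>k\<le>CARD('n). bstep c CARD('n) (\<lambda>k. \<bar>bary x k - bary y k\<bar>) k)"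
    unfolding bdist_def
  proof (rule sum_mono)
    fix k assume k: "k \<in> {..CARD('n)}"
    let ?e = "\<lambda>k. bary x k - bary y k"
    have "bary (branch c x) k - bary (branch c y) k = bstep c CARD('n) ?e k"
      using k by (simp add: bary_branch assms bstep_def field_simps)
    also have "\<bar>\<dots>\<bar> \<le> bstep c CARD('n) (\<lambda>k. \<bar>?e k\<bar>) k"
      using abs_triangle_ineq[of "?e 0" "?e 1 / 2"] by (simp add: bstep_def)
    finally show "\<bar>bary (branch c x) k - bary (branch c y) k\<bar> \<le> bstep c CARD('n) (\<lambda>k. \<bar>?e k\<bar>) k" .
  qed
  also have "\<dots> = bdist x y" by (simp add: bdist_def sum_bstep one_le_card)
  finally show ?thesis .
qed

text \<open>On the coordinates 1 to n, \<open>branch False\<close> is a rotation that halves the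
  entry wrapping around, so n rounds halve each entry once.\<close>

lemma bary_branch_False_funpow:
  fixes x :: "real ^ 'n::{finite,wellorder}"
  assumes x: "x \<in> \<Gamma>" and "j \<le> CARD('n)" "1 \<le> k" "k \<le> CARD('n)"
  shows "bary ((branch False ^^ j) x) k =
    (if k + j \<le> CARD('n) then bary x (k + j) else bary x (k + j - CARD('n)) / 2)"
  using assms(2-4)
proof (induction j arbitrary: k)
  case (Suc j)
  have "bary ((branch False ^^ Suc j) x) k = bstep False CARD('n) (bary ((branch False ^^ j) x)) k"
    using Suc.prems bary_branch[OF branch_funpow_Gamma[OF x]] by simp
  then show ?case
    using Suc.prems Suc.IH[of 1] Suc.IH[of "Suc k"] by (auto simp: bstep_def)
qed simp

lemma bdist_branch_False_card:
  fixes x y :: "real ^ 'n::{finite,wellorder}"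
  assumes x: "x \<in> \<Gamma>" and y: "y \<in> \<Gamma>"
  shows "bdist ((branch False ^^ CARD('n)) x) ((branch False ^^ CARD('n)) y) = bdist x y / 2"
proof -
  let ?x = "(branch False ^^ CARD('n)) x" and ?y = "(branch False ^^ CARD('n)) y"
  have S: "bary ?x (Suc k) - bary ?y (Suc k) = (bary x (Suc k) - bary y (Suc k)) / 2"
    if "k < CARD('n)" for k
    using bary_branch_False_funpow[OF x, of "CARD('n)" "Suc k"]
      bary_branch_False_funpow[OF y, of "CARD('n)" "Suc k"] that by (simp add: diff_divide_distrib)
  \<comment> \<open>Coordinate differences sum to 0, so coordinate 0 is halved along with the
    others.\<close>
  have z: "bary v 0 - bary w 0 = - (\<Sum>k<CARD('n). bary v (Suc k) - bary w (Suc k))"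
    for v w :: "real ^ 'n::{finite,wellorder}"
    using sum_bary[of v] sum_bary[of w] by (simp add: sum.atMost_shift sum_subtractf)
  have "(\<Sum>k<CARD('n). bary ?x (Suc k) - bary ?y (Suc k)) =
      (\<Sum>k<CARD('n). (bary x (Suc k) - bary y (Suc k)) / 2)"
    by (rule sum.cong) (auto simp only: S lessThan_iff)
  then have 0: "bary ?x 0 - bary ?y 0 = (bary x 0 - bary y 0) / 2"
    unfolding z[of ?x ?y] z[of x y] by (simp add: sum_divide_distrib)
  have "(\<Sum>k<CARD('n). \<bar>bary ?x (Suc k) - bary ?y (Suc k)\<bar>) =
      (\<Sum>k<CARD('n). \<bar>bary x (Suc k) - bary y (Suc k)\<bar> / 2)"
    by (rule sum.cong) (auto simp only: S lessThan_iff abs_divide abs_numeral)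
  then show ?thesis
    unfolding bdist_def sum.atMost_shift 0 by (simp add: add_divide_distrib sum_divide_distrib)
qed

text \<open>Of the 2^j branch words only the one made of \<open>branch False\<close> alone is
  tracked, with weight 2^-j; for all others nonexpansiveness suffices. The slack \<open>a\<close>
  admits functions that are not Lipschitz.\<close>

lemma avg_contract_aux:
  fixes g :: "real ^ 'n::{finite,wellorder} \<Rightarrow> real"
  assumes g: "\<And>x y. x \<in> \<Gamma> \<Longrightarrow> y \<in> \<Gamma> \<Longrightarrow> \<bar>g x - g y\<bar> \<le> a + C * bdist x y" and "0 \<le> C"
    and "x \<in> \<Gamma>" "y \<in> \<Gamma>"
  shows "\<bar>(avg ^^ j) g x - (avg ^^ j) g y\<bar> \<le> a + C * ((1 - (1/2)^j) * bdist x y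
    + (1/2)^j * bdist ((branch False ^^ j) x) ((branch False ^^ j) y))"
  using assms(3,4)
proof (induction j arbitrary: x y)
  case 0
  then show ?case using g by simp
next
  case (Suc j)
  let ?t = "(1/2)^j :: real" and ?h = "(avg ^^ j) g"
  let ?D = "bdist ((branch False ^^ Suc j) x) ((branch False ^^ Suc j) y)"
  have le: "bdist (branch c x) (branch c y) \<le> bdist x y" for c
    using Suc.prems by (rule bdist_branch)
  have t: "0 \<le> ?t" "?t \<le> 1" by (auto simp: power_le_one)
  have D: "bdist ((branch c ^^ i) u) ((branch c ^^ i) v) \<le> bdist u v"
    if "u \<in> \<Gamma>" "v \<in> \<Gamma>" for u v :: "real ^ 'n::{finite,wellorder}" and c i
  proof (induction i)
    case (Suc i)
    have "bdist ((branch c ^^ Suc i) u) ((branch c ^^ Suc i) v)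
        \<le> bdist ((branch c ^^ i) u) ((branch c ^^ i) v)"
      using bdist_branch[OF branch_funpow_Gamma branch_funpow_Gamma] that by simp
    with Suc show ?case by linarith
  qed simp
  have "\<bar>?h (branch False x) - ?h (branch False y)\<bar> \<le> a + C * ((1 - ?t) * bdist x y + ?t * ?D)"
  proof -
    have "\<bar>?h (branch False x) - ?h (branch False y)\<bar>
      \<le> a + C * ((1 - ?t) * bdist (branch False x) (branch False y) + ?t * ?D)"
      using Suc.IH[OF branch_Gamma[OF Suc.prems(1)] branch_Gamma[OF Suc.prems(2)]]
      by (simp add: funpow_swap1)
    also have "\<dots> \<le> a + C * ((1 - ?t) * bdist x y + ?t * ?D)"
      using le t \<open>0 \<le> C\<close> by (intro add_mono mult_left_mono) auto
    finally show ?thesis .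
  qed
  moreover have "\<bar>?h (branch True x) - ?h (branch True y)\<bar> \<le> a + C * bdist x y"
  proof -
    let ?u = "branch True x" and ?v = "branch True y"
    have G: "?u \<in> \<Gamma>" "?v \<in> \<Gamma>" using Suc.prems branch_Gamma by auto
    have "\<bar>?h ?u - ?h ?v\<bar> \<le> a + C * ((1 - ?t) * bdist ?u ?v
        + ?t * bdist ((branch False ^^ j) ?u) ((branch False ^^ j) ?v))"
      by (rule Suc.IH[OF G])
    also have "\<dots> \<le> a + C * ((1 - ?t) * bdist x y + ?t * bdist x y)"
      using le[of True] D[OF G, of j False] t \<open>0 \<le> C\<close>
      by (intro add_mono mult_left_mono) (auto intro: order_trans)
    finally show ?thesis by (simp add: algebra_simps)
  qed
  moreover have "\<bar>(avg ^^ Suc j) g x - (avg ^^ Suc j) g y\<bar>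
    \<le> (\<bar>?h (branch False x) - ?h (branch False y)\<bar> + \<bar>?h (branch True x) - ?h (branch True y)\<bar>) / 2"
  proof -
    have "\<bar>(p + q) / 2 - (r + s) / 2\<bar> \<le> (\<bar>p - r\<bar> + \<bar>q - s\<bar>) / 2" for p q r s :: real
      by (auto simp: abs_if field_simps)
    then show ?thesis by (simp only: funpow.simps o_apply avg_def[of ?h])
  qed
  ultimately show ?case by (simp add: algebra_simps)
qed

text \<open>Over n levels the tracked word halves the distance, so \<open>C\<close> shrinks by the
  factor 1 - 2^-n + 2^-n / 2, while the slack \<open>a\<close> does not accumulate.\<close>

lemma avg_contract:
  fixes g :: "real ^ 'n::{finite,wellorder} \<Rightarrow> real"
  assumes g: "\<And>x y. x \<in> \<Gamma> \<Longrightarrow> y \<in> \<Gamma> \<Longrightarrow> \<bar>g x - g y\<bar> \<le> a + C * bdist x y" and C: "0 \<le> C"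
    and "x \<in> \<Gamma>" "y \<in> \<Gamma>"
  shows "\<bar>(avg ^^ (CARD('n) * q)) g x - (avg ^^ (CARD('n) * q)) g y\<bar>
    \<le> a + C * (1 - (1/2) ^ Suc CARD('n)) ^ q * bdist x y"
  using assms(3,4)
proof (induction q arbitrary: x y)
  case 0
  then show ?case using g by simp
next
  case (Suc q)
  let ?r = "1 - (1/2) ^ Suc CARD('n) :: real"
  have r: "0 \<le> C * ?r ^ q" using C power_le_one[of "1/2::real" "Suc CARD('n)"] by (intro mult_nonneg_nonneg) auto
  have "\<bar>(avg ^^ CARD('n)) ((avg ^^ (CARD('n) * q)) g) x - (avg ^^ CARD('n)) ((avg ^^ (CARD('n) * q)) g) y\<bar>
    \<le> a + C * ?r ^ q * ((1 - (1/2) ^ CARD('n)) * bdist x y + (1/2) ^ CARD('n) *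
        bdist ((branch False ^^ CARD('n)) x) ((branch False ^^ CARD('n)) y))"
    by (rule avg_contract_aux[OF Suc.IH r Suc.prems])
  also have "\<dots> = a + C * ?r ^ Suc q * bdist x y"
    by (simp add: bdist_branch_False_card Suc.prems algebra_simps)
  finally show ?case by (simp add: funpow_add)
qed

lemma dist_le_bdist:
  fixes x y :: "real ^ 'n::{finite,wellorder}"
  shows "dist x y \<le> real CARD('n) * bdist x y"
proof -
  have "\<bar>(x - y) $ i\<bar> \<le> bdist x y" for i
  proof -
    obtain k where k: "k < CARD('n)" "i = ix k" by (rule ix_exhaust)
    have "(x - y) $ i = ext x (Suc k) - ext y (Suc k)" using k by (simp add: ext_def)
    also have "\<dots> = (\<Sum>j=Suc k..CARD('n). bary x j - bary y j)"
      using k by (simp add: sum_bary_tail sum_subtractf)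
    also have "\<bar>\<dots>\<bar> \<le> (\<Sum>j=Suc k..CARD('n). \<bar>bary x j - bary y j\<bar>)" by (rule sum_abs)
    also have "\<dots> \<le> bdist x y" unfolding bdist_def by (rule sum_mono2) auto
    finally show ?thesis .
  qed
  then have "(\<Sum>i\<in>UNIV. \<bar>(x - y) $ i\<bar>) \<le> (\<Sum>i\<in>(UNIV :: 'n set). bdist x y)" by (intro sum_mono)
  then show ?thesis using norm_le_l1_cart[of "x - y"] by (simp add: dist_norm)
qed

lemma continuous_bounded_Gamma:
  fixes f :: "real ^ 'n::{finite,wellorder} \<Rightarrow> real"
  assumes "continuous_on \<Gamma> f"
  obtains M where "0 < M" "\<And>x. x \<in> \<Gamma> \<Longrightarrow> \<bar>f x\<bar> \<le> M"
  using compact_imp_bounded[OF compact_continuous_image[OF assms compact_Gamma]]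
  unfolding bounded_pos by auto

text \<open>Closer than \<open>d\<close>, uniform continuity gives \<open>e\<close>; farther apart,
  2M is at most (2M/d) times the distance, so a large Lipschitz constant covers these pairs.\<close>

lemma continuous_almost_Lipschitz:
  fixes f :: "real ^ 'n::{finite,wellorder} \<Rightarrow> real"
  assumes f: "continuous_on \<Gamma> f" and "0 < e"
  obtains C where "0 \<le> C" "\<And>x y. x \<in> \<Gamma> \<Longrightarrow> y \<in> \<Gamma> \<Longrightarrow> \<bar>f x - f y\<bar> \<le> e + C * bdist x y"
proof -
  obtain d where d: "0 < d" "\<And>x y. x \<in> \<Gamma> \<Longrightarrow> y \<in> \<Gamma> \<Longrightarrow> dist y x < d \<Longrightarrow> dist (f y) (f x) < e"
    using compact_uniformly_continuous[OF f compact_Gamma] \<open>0 < e\<close>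
    unfolding uniformly_continuous_on_def by meson
  obtain M where M: "0 < M" "\<And>x. x \<in> \<Gamma> \<Longrightarrow> \<bar>f x\<bar> \<le> M"
    using continuous_bounded_Gamma[OF f] by blast
  let ?C = "2 * M / d * real CARD('n)"
  show thesis
  proof (rule that[of ?C])
    show "0 \<le> ?C" using M d by simp
    fix x y :: "real ^ 'n::{finite,wellorder}"
    assume xy: "x \<in> \<Gamma>" "y \<in> \<Gamma>"
    show "\<bar>f x - f y\<bar> \<le> e + ?C * bdist x y"
    proof (cases "dist x y < d")
      case True
      then have "\<bar>f x - f y\<bar> \<le> e" using d(2)[OF xy(2,1)] by (simp add: dist_real_def)
      moreover have "0 \<le> ?C * bdist x y" using M d bdist_nonneg by (intro mult_nonneg_nonneg) auto
      ultimately show ?thesis by linarith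
    next
      case False
      have "\<bar>f x - f y\<bar> \<le> 2 * M" using M(2)[OF xy(1)] M(2)[OF xy(2)] by linarith
      also have "\<dots> = 2 * M / d * d" using d by simp
      also have "\<dots> \<le> 2 * M / d * (real CARD('n) * bdist x y)"
        using False dist_le_bdist[of x y] M d by (intro mult_left_mono) auto
      finally show ?thesis using \<open>0 < e\<close> by (simp add: mult.assoc)
    qed
  qed
qed

lemma avg_oscillation:
  fixes f :: "real ^ 'n::{finite,wellorder} \<Rightarrow> real"
  assumes f: "continuous_on \<Gamma> f" and e: "0 < e"
  shows "\<exists>m. \<forall>x\<in>\<Gamma>. \<forall>y\<in>\<Gamma>. \<bar>(avg ^^ m) f x - (avg ^^ m) f y\<bar> \<le> e"
proof -
  obtain C where C: "0 \<le> C" "\<And>x y. x \<in> \<Gamma> \<Longrightarrow> y \<in> \<Gamma> \<Longrightarrow> \<bar>f x - f y\<bar> \<le> e / 2 + C * bdist x y"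
    using continuous_almost_Lipschitz[OF f, of "e / 2"] e by auto
  let ?r = "1 - (1/2) ^ Suc CARD('n) :: real"
  have r: "0 \<le> ?r" "?r < 1" using power_le_one[of "1/2::real" "Suc CARD('n)"] by auto
  have "(\<lambda>q. C * ?r ^ q * 2) \<longlonglongrightarrow> C * 0 * 2"
    using r by (intro tendsto_intros LIMSEQ_power_zero) auto
  then have "eventually (\<lambda>q. C * ?r ^ q * 2 < e / 2) sequentially"
    by (rule order_tendstoD(2)) (use e in simp)
  then obtain q where q: "C * ?r ^ q * 2 < e / 2" by (auto simp: eventually_sequentially)
  have "\<bar>(avg ^^ (CARD('n) * q)) f x - (avg ^^ (CARD('n) * q)) f y\<bar> \<le> e" if "x \<in> \<Gamma>" "y \<in> \<Gamma>" for x y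
  proof -
    have "C * ?r ^ q * bdist x y \<le> C * ?r ^ q * 2"
      using bdist_le_2[OF that] C r by (intro mult_left_mono) auto
    with q avg_contract[OF C(2) C(1) that, of q] show ?thesis by linarith
  qed
  then show ?thesis by blast
qed

section \<open>Invariance of the integral\<close>

definition tent_lin :: "bool \<Rightarrow> real ^ 'n::{finite,wellorder} \<Rightarrow> real ^ 'n::{finite,wellorder}" where
  "tent_lin c x = (\<chi> i. if i = first_ix then (if c then - 1 else 1) * (x $ first_ix + x $ last_ix)
     else x $ prev_ix i - x $ last_ix)"

text \<open>The derivative is taken within the half, since the tent map has a fold along the common
  boundary of the halves.\<close>

lemma tent_has_derivative:
  assumes "x \<in> bpiece c"
  shows "(tent has_derivative tent_lin c) (at x within bpiece c)"
proof -
  have "linear (tent_lin c)"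
    by (rule linearI) (auto simp: tent_lin_def vec_eq_iff algebra_simps)
  then have "(tent_lin c has_derivative tent_lin c) (at x within bpiece c)"
    by (intro bounded_linear_imp_has_derivative linear_conv_bounded_linear[THEN iffD1])
  then have "((\<lambda>x. tent_lin c x + (if c then axis first_ix 2 else 0)) has_derivative tent_lin c)
      (at x within bpiece c)"
    by (auto intro!: derivative_eq_intros)
  then show ?thesis
  proof (rule has_derivative_transform[OF assms, rotated])
    fix y assume "y \<in> bpiece c"
    then show "tent y = tent_lin c y + (if c then axis first_ix 2 else 0)"
      by (auto simp: tent_def tent_lin_def bpiece_def piece_iff[symmetric] vec_eq_iff axis_def)
  qed
qed

text \<open>The two linear parts differ only in the sign of the first row. The value of the
  determinant comes out of a volume comparison in \<open>integral_avg\<close>.\<close>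

lemma abs_det_tent_lin:
  "\<bar>det (matrix (tent_lin c :: _ \<Rightarrow> real ^ 'n::{finite,wellorder}))\<bar>
    = \<bar>det (matrix (tent_lin False :: _ \<Rightarrow> real ^ 'n::{finite,wellorder}))\<bar>"
proof -
  let ?a = "\<lambda>i :: 'n. (\<chi> j. axis j 1 $ first_ix + axis j 1 $ last_ix) :: real ^ 'n::{finite,wellorder}"
  let ?b = "\<lambda>i :: 'n. (\<chi> j. axis j 1 $ prev_ix i - axis j 1 $ last_ix) :: real ^ 'n::{finite,wellorder}"
  have "matrix (tent_lin c) =
      (\<chi> i. if i = first_ix then (if c then - 1 else 1) *s ?a i else ?b i)" for c
    by (auto simp: matrix_def tent_lin_def vec_eq_iff)
  then show ?thesis by (simp add: det_row_mul abs_mult)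
qed

lemma integral_change_of_variables_real:
  fixes f :: "real ^ 'm::{finite,wellorder} \<Rightarrow> real" and g :: "real^'m::{finite,wellorder} \<Rightarrow> real^'m::{finite,wellorder}"
  assumes "S \<in> sets lebesgue" "\<And>x. x \<in> S \<Longrightarrow> (g has_derivative g' x) (at x within S)" "inj_on g S"
    and "f absolutely_integrable_on (g ` S)"
  shows "integral (g ` S) f = integral S (\<lambda>x. \<bar>det (matrix (g' x))\<bar> * f (g x))"
  using integral_change_of_variables[OF assms(1-3), of "\<lambda>x. vec (f x) :: real ^ 1"] assms(4)
  by (simp add: integral_on_1_eq absolutely_integrable_on_1_iff)

lemma tent_image: "tent ` bpiece c = \<Gamma>"
proof
  show "tent ` bpiece c \<subseteq> \<Gamma>" by (auto intro: tent_Gamma bpiece_Gamma)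
  show "\<Gamma> \<subseteq> tent ` bpiece c" by (metis branch_piece tent_branch image_eqI subsetI)
qed

text \<open>The inverse of a continuous injection on a compact set is continuous.\<close>

lemma continuous_branch:
  "continuous_on \<Gamma> (branch c :: _ \<Rightarrow> real ^ 'n::{finite,wellorder})"
proof -
  have "continuous_on (bpiece c) (tent :: _ \<Rightarrow> real ^ 'n::{finite,wellorder})"
    using tent_has_derivative has_derivative_continuous continuous_on_eq_continuous_within by blast
  from continuous_on_inv[OF this compact_bpiece, of "branch c"] show ?thesis
    by (simp add: branch_tent tent_image)
qed

lemma continuous_comp_branch:
  assumes "continuous_on \<Gamma> f"
  shows "continuous_on \<Gamma> (\<lambda>y. f (branch c y))"
  by (rule continuous_on_compose2[OF assms continuous_branch]) (auto intro: branch_Gamma)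

lemma continuous_avg_funpow:
  assumes "continuous_on \<Gamma> f"
  shows "continuous_on \<Gamma> ((avg ^^ m) f)"
proof (induction m)
  case (Suc m)
  then show ?case using continuous_comp_branch[OF Suc]
    by (auto simp: avg_def[abs_def] intro!: continuous_intros)
qed (simp add: assms)

lemma absolutely_integrable_compact:
  fixes f :: "'a::euclidean_space \<Rightarrow> real"
  assumes "compact S" "continuous_on S f"
  shows "f absolutely_integrable_on S"
  using borel_integrable_compact[OF assms]
  unfolding set_integrable_def by (simp add: integrable_completion)

lemma integral_branch:
  fixes f :: "real ^ 'n::{finite,wellorder} \<Rightarrow> real"
  assumes "continuous_on \<Gamma> f"
  shows "integral \<Gamma> (\<lambda>y. f (branch c y)) =
    \<bar>det (matrix (tent_lin False :: _ \<Rightarrow> real ^ 'n::{finite,wellorder}))\<bar> * integral (bpiece c) f"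
proof -
  have "(\<lambda>y. f (branch c y)) absolutely_integrable_on \<Gamma>"
    by (intro absolutely_integrable_compact compact_Gamma continuous_comp_branch assms)
  then have "integral (tent ` bpiece c) (\<lambda>y. f (branch c y)) =
      integral (bpiece c) (\<lambda>x. \<bar>det (matrix (tent_lin c :: _ \<Rightarrow> real ^ 'n::{finite,wellorder}))\<bar> * f (branch c (tent x)))"
    by (intro integral_change_of_variables_real inj_on_tent tent_has_derivative
        fmeasurableD[OF lmeasurable_compact[OF compact_bpiece]]) (auto simp: tent_image)
  also have "\<dots> = integral (bpiece c) (\<lambda>x. \<bar>det (matrix (tent_lin c :: _ \<Rightarrow> real ^ 'n::{finite,wellorder}))\<bar> * f x)"
    by (rule integral_cong) (simp add: branch_tent)
  finally show ?thesis by (simp add: tent_image abs_det_tent_lin[of c])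
qed

lemma integral_pieces:
  fixes f :: "real ^ 'n::{finite,wellorder} \<Rightarrow> real"
  assumes f: "continuous_on \<Gamma> f"
  shows "integral \<Gamma> f = integral (bpiece False) f + integral (bpiece True) f"
proof -
  have i: "f integrable_on bpiece c" for c
  proof -
    have "continuous_on (bpiece c) f" by (rule continuous_on_subset[OF f]) (auto intro: bpiece_Gamma)
    then show ?thesis
      using absolutely_integrable_compact[OF compact_bpiece] set_lebesgue_integral_eq_integral(1) by blast
  qed
  \<comment> \<open>The overlap of the halves lies in the hyperplane alpha_1 + alpha_n = 1.\<close>
  have "(bpiece False :: (real ^ 'n::{finite,wellorder}) set) \<inter> bpiece True
      \<subseteq> {x. (axis first_ix 1 + axis last_ix 1) \<bullet> x = 1}"
    by (auto simp: bpiece_def bary_0 bary_last inner_add_left inner_axis')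
  then have "negligible ((bpiece False :: (real ^ 'n::{finite,wellorder}) set) \<inter> bpiece True)"
    by (rule negligible_subset[OF negligible_hyperplane, rotated]) simp
  with i show ?thesis by (simp flip: bpiece_Un)
qed

section \<open>Interior points, volume and means\<close>

definition interior_pts :: "(real ^ 'n::{finite,wellorder}) set" where
  "interior_pts = {\<alpha>. \<forall>k\<le>CARD('n). 0 < bary \<alpha> k}"

lemma interior_pts_Gamma: "interior_pts \<subseteq> \<Gamma>"
  by (auto simp: interior_pts_def Gamma_iff less_imp_le)

lemma interior_contains_box:
  obtains a b :: "real ^ 'n::{finite,wellorder}"
  where "box a b \<noteq> {}" "cbox a b \<subseteq> interior_pts"
proof -
  have "interior_pts = (\<Inter>k\<in>{..CARD('n)}. {\<alpha> :: real ^ 'n::{finite,wellorder}. 0 < bary \<alpha> k})"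
    by (auto simp: interior_pts_def)
  also have "open \<dots>" by (intro open_INT ballI open_Collect_less continuous_intros) auto
  finally have o: "open (interior_pts :: (real ^ 'n::{finite,wellorder}) set)" .
  \<comment> \<open>The barycentre of the simplex serves as an interior point.\<close>
  have "(\<Sum>j\<le>CARD('n). 1 / real (Suc CARD('n))) = 1" by simp
  then obtain c :: "real ^ 'n::{finite,wellorder}"
    where "\<And>k. k \<le> CARD('n) \<Longrightarrow> bary c k = 1 / real (Suc CARD('n))"
    using exists_bary by blast
  then have "c \<in> interior_pts" by (simp add: interior_pts_def)
  with o obtain a b where "cbox a b \<subseteq> interior_pts" "c \<in> box a b"
    by (metis open_contains_cbox)
  then show thesis using that by blast
qed

lemma measure_Gamma_pos: "0 < measure lebesgue (\<Gamma> :: (real ^ 'n::{finite,wellorder}) set)"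
proof -
  obtain a b :: "real ^ 'n::{finite,wellorder}"
    where ab: "box a b \<noteq> {}" "cbox a b \<subseteq> interior_pts" by (rule interior_contains_box)
  have "0 < measure lebesgue (cbox a b)" using ab(1) by (simp add: content_pos_lt_eq box_ne_empty)
  also have "\<dots> \<le> measure lebesgue (\<Gamma> :: (real ^ 'n::{finite,wellorder}) set)"
    using ab(2) interior_pts_Gamma
    by (intro measure_mono_fmeasurable lmeasurable_compact compact_Gamma) auto
  finally show ?thesis .
qed

lemma integral_avg:
  fixes f :: "real ^ 'n::{finite,wellorder} \<Rightarrow> real"
  assumes f: "continuous_on \<Gamma> f"
  shows "integral \<Gamma> (avg f) = integral \<Gamma> f"
proof -
  let ?d = "\<bar>det (matrix (tent_lin False :: _ \<Rightarrow> real ^ 'n::{finite,wellorder}))\<bar>"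
  have i: "(\<lambda>y. h (branch c y)) integrable_on \<Gamma>" if "continuous_on \<Gamma> h"
    for c and h :: "real ^ 'n::{finite,wellorder} \<Rightarrow> real"
    using absolutely_integrable_compact[OF compact_Gamma continuous_comp_branch[OF that]]
    by (rule set_lebesgue_integral_eq_integral(1))
  have *: "2 * integral \<Gamma> (avg h) = ?d * integral \<Gamma> h" if "continuous_on \<Gamma> h"
    for h :: "real ^ 'n::{finite,wellorder} \<Rightarrow> real"
  proof -
    have "2 * integral \<Gamma> (avg h) = integral \<Gamma> (\<lambda>y. h (branch False y)) + integral \<Gamma> (\<lambda>y. h (branch True y))"
      using i[OF that] by (simp add: avg_def[abs_def] integral_add)
    then show ?thesis by (simp add: integral_branch[OF that] integral_pieces[OF that] distrib_left)
  qed
  \<comment> \<open>The constant 1 is averaged to itself, and the volume is positive; comparing both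
    sides of \<open>*\<close> shows that the determinant has absolute value 2.\<close>
  have "integral (\<Gamma> :: (real ^ 'n::{finite,wellorder}) set) (\<lambda>_. 1::real) > 0"
    using measure_Gamma_pos lmeasure_integral[OF lmeasurable_compact[OF compact_Gamma]] by metis
  moreover have "avg (\<lambda>_. 1) = (\<lambda>_ :: real ^ 'n::{finite,wellorder}. 1)" by (simp add: avg_def[abs_def])
  ultimately have "?d = 2" using *[of "\<lambda>_. 1"] by simp
  then show ?thesis using *[OF f] by simp
qed

lemma Gamma_measure_integral:
  fixes f :: "real ^ 'n::{finite,wellorder} \<Rightarrow> real"
  assumes f: "continuous_on \<Gamma> f"
  shows "(LINT x|\<Gamma>_measure. f x) = integral \<Gamma> f / measure lebesgue (\<Gamma> :: (real ^ 'n::{finite,wellorder}) set)"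
proof -
  let ?G = "\<Gamma> :: (real ^ 'n::{finite,wellorder}) set"
  let ?c = "measure lebesgue ?G"
  have L: "?G \<in> lmeasurable" by (rule lmeasurable_compact[OF compact_Gamma])
  then have S: "?G \<in> sets lebesgue" by blast
  have e: "emeasure (lebesgue_on ?G) ?G = ennreal ?c"
    using emeasure_restrict_space[of ?G lebesgue ?G] emeasure_eq_measure2[OF L] S by simp
  have [measurable]: "?G \<in> sets (lebesgue_on ?G)"
    using sets.top[of "lebesgue_on ?G"] by (simp add: space_lebesgue_on)
  have m: "(\<lambda>x. indicator ?G x / ennreal ?c) \<in> borel_measurable (lebesgue_on ?G)"
    by measurable
  have "\<Gamma>_measure = density (lebesgue_on ?G) (\<lambda>x. ennreal (1 / ?c))"
    unfolding \<Gamma>_measure_def uniform_measure_def e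
    by (rule density_cong)
      (use m measure_Gamma_pos[where 'n='n] in \<open>auto simp: indicator_def divide_ennreal[symmetric] intro!: AE_I2\<close>)
  moreover have "integral\<^sup>L (density (lebesgue_on ?G) (\<lambda>x. ennreal (1 / ?c))) f
      = (LINT x|lebesgue_on ?G. (1 / ?c) *\<^sub>R f x)"
    by (rule integral_density) (auto intro: continuous_imp_measurable_on_sets_lebesgue[OF f S])
  ultimately have "(LINT x|\<Gamma>_measure. f x) = (LINT x|lebesgue_on ?G. (1 / ?c) *\<^sub>R f x)"
    by simp
  also have "\<dots> = (1 / ?c) * (LINT x|lebesgue_on ?G. f x)" by simp
  also have "(LINT x|lebesgue_on ?G. f x) = integral ?G f"
    by (intro lebesgue_integral_eq_integral S absolutely_integrable_imp_integrable
        absolutely_integrable_compact compact_Gamma f)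
  finally show ?thesis by simp
qed

lemma integral_avg_funpow:
  fixes f :: "real ^ 'n::{finite,wellorder} \<Rightarrow> real"
  assumes f: "continuous_on \<Gamma> f"
  shows "integral \<Gamma> ((avg ^^ m) f) = integral \<Gamma> f"
  by (induction m) (simp_all add: integral_avg[OF continuous_avg_funpow[OF f]])

text \<open>For suitable m the averaged function oscillates by at most \<open>e\<close> and has the
  same mean as \<open>f\<close>, so all its values are within \<open>e\<close> of that mean.\<close>

lemma avg_uniform_limit:
  fixes f :: "real ^ 'n::{finite,wellorder} \<Rightarrow> real"
  assumes f: "continuous_on \<Gamma> f" and e: "0 < e"
  shows "\<exists>m. \<forall>y\<in>\<Gamma>. \<bar>(avg ^^ m) f y - (LINT x|\<Gamma>_measure. f x)\<bar> \<le> e"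
proof -
  let ?G = "\<Gamma> :: (real ^ 'n::{finite,wellorder}) set"
  let ?c = "measure lebesgue ?G"
  obtain m where m: "\<And>x y. x \<in> \<Gamma> \<Longrightarrow> y \<in> \<Gamma> \<Longrightarrow> \<bar>(avg ^^ m) f x - (avg ^^ m) f y\<bar> \<le> e"
    using avg_oscillation[OF f e] by blast
  let ?h = "(avg ^^ m) f"
  have L: "?G \<in> lmeasurable" by (rule lmeasurable_compact[OF compact_Gamma])
  have hi: "?h integrable_on \<Gamma>"
    using absolutely_integrable_compact[OF compact_Gamma continuous_avg_funpow[OF f]]
    by (rule set_lebesgue_integral_eq_integral(1))
  have ci: "(\<lambda>_. k) integrable_on ?G" for k :: real
    using L integrable_on_const by blast
  have cv: "integral ?G (\<lambda>_. k) = k * ?c" for k :: real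
    using lmeasure_integral[OF L] integral_mult_right[of ?G k "\<lambda>_. 1"] by simp
  have mean: "(LINT x|\<Gamma>_measure. f x) = integral \<Gamma> ?h / ?c"
    by (simp add: Gamma_measure_integral[OF f] integral_avg_funpow[OF f])
  have "\<bar>?h y - (LINT x|\<Gamma>_measure. f x)\<bar> \<le> e" if y: "y \<in> \<Gamma>" for y
  proof -
    have "(?h y - e) * ?c \<le> integral \<Gamma> ?h"
      unfolding cv[symmetric] using m[OF y] by (intro integral_le ci hi) (simp add: abs_le_iff algebra_simps)
    moreover have "integral \<Gamma> ?h \<le> (?h y + e) * ?c"
      unfolding cv[symmetric] using m[OF _ y] by (intro integral_le ci hi) (simp add: abs_le_iff algebra_simps)
    ultimately have "?h y - e \<le> integral \<Gamma> ?h / ?c" "integral \<Gamma> ?h / ?c \<le> ?h y + e"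
      using measure_Gamma_pos[where 'n='n] by (simp_all add: pos_le_divide_eq pos_divide_le_eq)
    then show ?thesis unfolding mean by linarith
  qed
  then show ?thesis by blast
qed

section \<open>Sums over preimages\<close>

lemma interior_branch:
  fixes y :: "real ^ 'n::{finite,wellorder}"
  assumes "y \<in> interior_pts"
  shows "branch c y \<in> interior_pts"
proof -
  have y: "y \<in> \<Gamma>" using assms interior_pts_Gamma by blast
  have "0 < bary y k" if "k \<le> CARD('n)" for k using assms that by (simp add: interior_pts_def)
  moreover from this[of 0] this[of 1] have "0 < bary y 0 + bary y (Suc 0) / 2"
    using one_le_card[where 'n='n] by simp
  ultimately show ?thesis
    using one_le_card[where 'n='n] by (auto simp: interior_pts_def bary_branch[OF y] bstep_def)
qed

lemma avg_step:
  "avg ((avg ^^ m) h) y = ((avg ^^ m) h (branch False y) + (avg ^^ m) h (branch True y)) / 2"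
  by (simp add: avg_def)

lemma psum_step:
  "psum ((psum ^^ m) h) y =
    (if 0 < bary y 0 then (psum ^^ m) h (branch False y) else 0) + (psum ^^ m) h (branch True y)"
  by (simp add: psum_def)

lemma avg_funpow_mono:
  assumes "\<And>x. x \<in> \<Gamma> \<Longrightarrow> h x \<le> g x" and "y \<in> \<Gamma>"
  shows "(avg ^^ m) h y \<le> (avg ^^ m) g y"
  using assms(2)
proof (induction m arbitrary: y)
  case (Suc m)
  note IH = Suc.IH[OF branch_Gamma[OF Suc.prems]]
  show ?case using IH[of False] IH[of True] by (simp add: avg_step)
qed (use assms in simp)

lemma avg_funpow_linear:
  "(avg ^^ m) (\<lambda>x. a * h x + b * g x) = (\<lambda>x. a * (avg ^^ m) h x + b * (avg ^^ m) g x)"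
  by (induction m) (auto simp: avg_step fun_eq_iff algebra_simps add_divide_distrib)

lemma avg_funpow_const: "(avg ^^ m) (\<lambda>_. a) = (\<lambda>_. a)"
  by (induction m) (auto simp: avg_step fun_eq_iff)

lemma psum_funpow_mono:
  fixes h :: "real ^ 'n::{finite,wellorder} \<Rightarrow> real"
  assumes "\<And>x. x \<in> \<Gamma> \<Longrightarrow> h x \<le> g x" and "y \<in> \<Gamma>"
  shows "(psum ^^ m) h y \<le> (psum ^^ m) g y"
  using assms(2)
proof (induction m arbitrary: y)
  case (Suc m)
  note IH = Suc.IH[OF branch_Gamma[OF Suc.prems]]
  show ?case using IH[of False] IH[of True] by (simp add: psum_step)
qed (use assms in simp)

lemma psum_funpow_linear:
  fixes h g :: "real ^ 'n::{finite,wellorder} \<Rightarrow> real"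
  shows "(psum ^^ m) (\<lambda>x. a * h x + b * g x) = (\<lambda>x. a * (psum ^^ m) h x + b * (psum ^^ m) g x)"
  by (induction m) (auto simp: psum_step fun_eq_iff algebra_simps)

lemma abs_psum_funpow_le:
  fixes h :: "real ^ 'n::{finite,wellorder} \<Rightarrow> real"
  assumes "\<And>x. x \<in> \<Gamma> \<Longrightarrow> \<bar>h x\<bar> \<le> g x" and "y \<in> \<Gamma>"
  shows "\<bar>(psum ^^ m) h y\<bar> \<le> (psum ^^ m) g y"
  using assms(2)
proof (induction m arbitrary: y)
  case (Suc m)
  note IH = Suc.IH[OF branch_Gamma[OF Suc.prems]]
  show ?case
    using IH[of True] order_trans[OF abs_triangle_ineq add_mono[OF IH[of False] IH[of True]]]
    by (simp add: psum_step)
qed (use assms in simp)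

lemma psum_funpow_nonneg:
  fixes h :: "real ^ 'n::{finite,wellorder} \<Rightarrow> real"
  assumes "\<And>x. x \<in> \<Gamma> \<Longrightarrow> 0 \<le> h x" and "y \<in> \<Gamma>"
  shows "0 \<le> (psum ^^ m) h y"
  using assms(2)
  by (induction m arbitrary: y) (auto simp: psum_step branch_Gamma assms(1))

lemma psum_funpow_le_avg:
  fixes h :: "real ^ 'n::{finite,wellorder} \<Rightarrow> real"
  assumes "\<And>x. x \<in> \<Gamma> \<Longrightarrow> 0 \<le> h x" and "y \<in> \<Gamma>"
  shows "(psum ^^ m) h y \<le> 2 ^ m * (avg ^^ m) h y"
  using assms(2)
proof (induction m arbitrary: y)
  case (Suc m)
  have "0 \<le> (psum ^^ m) h (branch False y)"
    by (intro psum_funpow_nonneg branch_Gamma assms(1) Suc.prems)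
  then have "(psum ^^ Suc m) h y \<le> (psum ^^ m) h (branch False y) + (psum ^^ m) h (branch True y)"
    by (simp add: psum_step)
  also have "\<dots> \<le> 2 ^ m * (avg ^^ m) h (branch False y) + 2 ^ m * (avg ^^ m) h (branch True y)"
    by (intro add_mono Suc.IH branch_Gamma Suc.prems)
  finally show ?case by (simp add: avg_step distrib_left)
qed simp

text \<open>At each level either both preimages are counted, and their sum is at least their mean,
  or they coincide and the mean is the one counted value.\<close>

lemma avg_funpow_le_psum:
  fixes h :: "real ^ 'n::{finite,wellorder} \<Rightarrow> real"
  assumes "\<And>x. x \<in> \<Gamma> \<Longrightarrow> 0 \<le> h x" and "y \<in> \<Gamma>"
  shows "(avg ^^ m) h y \<le> (psum ^^ m) h y"
  using assms(2)
proof (induction m arbitrary: y)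
  case (Suc m)
  have nn: "0 \<le> (psum ^^ m) h (branch c y)" for c
    by (intro psum_funpow_nonneg branch_Gamma assms(1) Suc.prems)
  have "(avg ^^ Suc m) h y \<le> ((psum ^^ m) h (branch False y) + (psum ^^ m) h (branch True y)) / 2"
    using Suc.IH[OF branch_Gamma[OF Suc.prems]] by (simp add: avg_step add_mono)
  also have "\<dots> \<le> (psum ^^ Suc m) h y"
    using nn[of False] nn[of True] branches_agree[OF Suc.prems] by (auto simp: psum_step)
  finally show ?case .
qed simp

text \<open>Preimages of interior points stay interior, where coordinate 0 is positive, so no two
  preimages are ever merged.\<close>

lemma psum_funpow_interior:
  fixes h :: "real ^ 'n::{finite,wellorder} \<Rightarrow> real"
  assumes "y \<in> interior_pts"
  shows "(psum ^^ m) h y = 2 ^ m * (avg ^^ m) h y"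
  using assms
proof (induction m arbitrary: y)
  case (Suc m)
  have "0 < bary y 0" using Suc.prems by (simp add: interior_pts_def)
  then show ?case
    using Suc.IH[OF interior_branch[OF Suc.prems]] by (simp add: psum_step avg_step distrib_left)
qed simp

text \<open>The indicator is not continuous, so \<open>avg_uniform_limit\<close> is applied to a
  continuous minorant: the product of the barycentric coordinates, which on the simplex is at most 1
  and vanishes off the interior. Its mean is positive, and half of it serves as
  \<open>\<eta>\<close>.\<close>

lemma avg_indicator_interior_pos:
  obtains L \<eta> where "0 < \<eta>"
    "\<And>y :: real ^ 'n::{finite,wellorder}. y \<in> \<Gamma> \<Longrightarrow> \<eta> \<le> (avg ^^ L) (indicat_real interior_pts) y"
proof -
  let ?G = "\<Gamma> :: (real ^ 'n::{finite,wellorder}) set"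
  define g where "g x = (\<Prod>k\<le>CARD('n). bary x k)" for x :: "real ^ 'n::{finite,wellorder}"
  have cont: "continuous_on S g" for S unfolding g_def by (intro continuous_intros)
  have g0: "0 \<le> g x" if "x \<in> \<Gamma>" for x
    unfolding g_def using that bary_nonneg by (intro prod_nonneg) auto
  have g1: "g x \<le> indicat_real interior_pts x" if x: "x \<in> \<Gamma>" for x
  proof (cases "x \<in> interior_pts")
    case True
    then show ?thesis
      unfolding g_def using x bary_nonneg bary_le_1 by (auto intro!: prod_le_1)
  next
    case False
    then obtain k where "k \<le> CARD('n)" "bary x k = 0"
      using bary_nonneg[OF x] by (force simp: interior_pts_def)
    then have "g x = 0" unfolding g_def by (intro prod_zero) auto
    then show ?thesis by simp
  qed
  obtain a b :: "real ^ 'n::{finite,wellorder}"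
    where ab: "box a b \<noteq> {}" "cbox a b \<subseteq> interior_pts" by (rule interior_contains_box)
  have sub: "cbox a b \<subseteq> \<Gamma>" using ab(2) interior_pts_Gamma by blast
  have gi: "g integrable_on S" if "compact S" for S
    using absolutely_integrable_compact[OF that cont] by (rule set_lebesgue_integral_eq_integral(1))
  have gp: "0 < g x" if "x \<in> cbox a b" for x
    unfolding g_def using that ab(2) by (intro prod_pos) (auto simp: interior_pts_def)
  have "integral (cbox a b) g \<noteq> 0"
    using integral_cbox_eq_0_iff[OF cont ab(1)] gp ab(1) box_subset_cbox[of a b]
    by (metis all_not_in_conv less_imp_le less_irrefl subsetD)
  moreover have "0 \<le> integral (cbox a b) g"
    by (intro integral_nonneg gi compact_cbox) (use gp in \<open>auto intro: less_imp_le\<close>)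
  moreover have "integral (cbox a b) g \<le> integral \<Gamma> g"
    using g0 by (intro integral_subset_le sub gi compact_cbox compact_Gamma) auto
  ultimately have "0 < integral \<Gamma> g" by linarith
  then have pos: "0 < (LINT x|\<Gamma>_measure. g x)"
    using measure_Gamma_pos[where 'n='n] by (simp add: Gamma_measure_integral[OF cont])
  then obtain L where L: "\<And>y. y \<in> \<Gamma> \<Longrightarrow>
      \<bar>(avg ^^ L) g y - (LINT x|\<Gamma>_measure. g x)\<bar> \<le> (LINT x|\<Gamma>_measure. g x) / 2"
    using avg_uniform_limit[OF cont, of "(LINT x|\<Gamma>_measure. g x) / 2"] by auto
  have "(LINT x|\<Gamma>_measure. g x) / 2 \<le> (avg ^^ L) (indicat_real interior_pts) y" if y: "y \<in> \<Gamma>"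
    for y :: "real ^ 'n::{finite,wellorder}"
    using L[OF y] avg_funpow_mono[of g "indicat_real interior_pts" y L, OF g1 y] by linarith
  then show thesis using that[of "(LINT x|\<Gamma>_measure. g x) / 2" L] pos by simp
qed

text \<open>At depth L (q + 1) there are at most 2^(L (q + 1)) (1 - \<open>\<eta>\<close>)^(q + 1)
  boundary preimages but at least \<open>\<eta>\<close> 2^(L q) interior ones; for large q the ratio
  falls below \<open>d\<close>.\<close>

lemma psum_boundary_negligible:
  assumes d: "0 < d"
  obtains j where "\<And>y :: real ^ 'n::{finite,wellorder}. y \<in> \<Gamma> \<Longrightarrow>
    (psum ^^ j) (indicat_real (- interior_pts)) y \<le> d * (psum ^^ j) (indicat_real interior_pts) y"
proof -
  let ?J = "indicat_real (interior_pts :: (real ^ 'n::{finite,wellorder}) set)"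
  let ?B = "indicat_real (- interior_pts :: (real ^ 'n::{finite,wellorder}) set)"
  obtain L \<eta> where \<eta>: "0 < \<eta>" and J: "\<And>y. y \<in> \<Gamma> \<Longrightarrow> \<eta> \<le> (avg ^^ L) ?J y"
    using avg_indicator_interior_pos by blast
  have B: "?B = (\<lambda>x. 1 * 1 + (-1) * ?J x)" by (auto simp: indicator_def fun_eq_iff)
  have AB: "(avg ^^ m) ?B y = 1 - (avg ^^ m) ?J y" for m y
    unfolding B avg_funpow_linear by (simp add: avg_funpow_const)
  have intB: "(avg ^^ m) ?B y = 0" if "y \<in> interior_pts" for m y
    using that by (induction m arbitrary: y) (auto simp: avg_step interior_branch)
  have r: "0 \<le> 1 - \<eta>"
  proof -
    have "0 \<le> (avg ^^ L) ?B 0"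
      using avg_funpow_mono[OF _ zero_Gamma, of "\<lambda>_. 0" ?B L] by (simp add: avg_funpow_const)
    then show ?thesis using J[OF zero_Gamma] by (simp add: AB)
  qed
  \<comment> \<open>Interior points have no boundary preimages; over any other point the boundary
    has weight at most 1 - \<open>\<eta>\<close> after L levels.\<close>
  have step: "(avg ^^ L) ?B y \<le> (1 - \<eta>) * ?B y" if "y \<in> \<Gamma>" for y
    using J[OF that] intB[of y L] by (cases "y \<in> interior_pts") (auto simp: AB)
  have decay: "(avg ^^ (L * q)) ?B y \<le> (1 - \<eta>) ^ q" if y: "y \<in> \<Gamma>" for q y
    using y
  proof (induction q arbitrary: y)
    case 0
    then show ?case by (simp add: indicator_def)
  next
    case (Suc q)
    have "(avg ^^ (L * Suc q)) ?B y = (avg ^^ (L * q)) ((avg ^^ L) ?B) y"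
      by (simp add: add.commute[of L] funpow_add)
    \<comment> \<open>The summand \<open>0 * 0\<close> only gives the function the shape of
      \<open>avg_funpow_linear\<close>.\<close>
    also have "\<dots> \<le> (avg ^^ (L * q)) (\<lambda>y. (1 - \<eta>) * ?B y + 0 * 0) y"
      using step by (intro avg_funpow_mono Suc.prems) simp
    also have "\<dots> = (1 - \<eta>) * (avg ^^ (L * q)) ?B y" by (subst avg_funpow_linear) simp
    also have "\<dots> \<le> (1 - \<eta>) * (1 - \<eta>) ^ q" by (intro mult_left_mono Suc.IH Suc.prems r)
    finally show ?case by simp
  qed
  have "(\<lambda>q. 2 ^ L / \<eta> * (1 - \<eta>) ^ Suc q) \<longlonglongrightarrow> 2 ^ L / \<eta> * 0"
    using r \<eta> by (intro tendsto_intros LIMSEQ_Suc LIMSEQ_power_zero) auto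
  then have "eventually (\<lambda>q. 2 ^ L / \<eta> * (1 - \<eta>) ^ Suc q < d) sequentially"
    by (rule order_tendstoD(2)) (use d in simp)
  then obtain q where q: "2 ^ L / \<eta> * (1 - \<eta>) ^ Suc q < d" by (auto simp: eventually_sequentially)
  let ?k = "L * q"
  show thesis
  proof (rule that[of "L * Suc q"])
    fix y :: "real ^ 'n::{finite,wellorder}"
    assume y: "y \<in> \<Gamma>"
    \<comment> \<open>The first L levels yield interior points of total weight at least
      \<open>\<eta>\<close>, each of which has 2^(L q) distinct preimages on the remaining levels,
      all interior.\<close>
    have "2 ^ ?k * \<eta> \<le> 2 ^ ?k * (avg ^^ L) ?J y + 0 * (avg ^^ L) (\<lambda>_. 0) y"
      using J[OF y] by simp
    also have "\<dots> = (avg ^^ L) (\<lambda>x. 2 ^ ?k * ?J x + 0 * 0) y" by (subst avg_funpow_linear) simp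
    also have "\<dots> \<le> (psum ^^ L) (\<lambda>x. 2 ^ ?k * ?J x + 0 * 0) y"
      by (intro avg_funpow_le_psum y) simp
    also have "\<dots> \<le> (psum ^^ L) ((psum ^^ ?k) ?J) y"
    proof (intro psum_funpow_mono y)
      fix x :: "real ^ 'n::{finite,wellorder}"
      assume x: "x \<in> \<Gamma>"
      show "2 ^ ?k * ?J x + 0 * 0 \<le> (psum ^^ ?k) ?J x"
      proof (cases "x \<in> interior_pts")
        case True
        have "(avg ^^ ?k) ?J x = 1" using AB[of ?k x] intB[OF True, of ?k] by simp
        then show ?thesis using psum_funpow_interior[OF True, of ?k ?J] True by simp
      next
        case False
        then show ?thesis using psum_funpow_nonneg[OF _ x, of ?J ?k] by simp
      qed
    qed
    also have "\<dots> = (psum ^^ (L * Suc q)) ?J y" by (simp add: funpow_add)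
    finally have lower: "2 ^ ?k * \<eta> \<le> (psum ^^ (L * Suc q)) ?J y" .
    have "(psum ^^ (L * Suc q)) ?B y \<le> 2 ^ (L * Suc q) * (avg ^^ (L * Suc q)) ?B y"
      by (intro psum_funpow_le_avg y) simp
    also have "\<dots> \<le> 2 ^ (L * Suc q) * (1 - \<eta>) ^ Suc q"
      by (intro mult_left_mono decay y) simp
    also have "\<dots> = (2 ^ L / \<eta> * (1 - \<eta>) ^ Suc q) * (2 ^ ?k * \<eta>)"
      using \<eta> by (simp add: power_add)
    also have "\<dots> \<le> d * (2 ^ ?k * \<eta>)" using q \<eta> by (intro mult_right_mono) auto
    also have "\<dots> \<le> d * (psum ^^ (L * Suc q)) ?J y" using lower d by (intro mult_left_mono) auto
    finally show "(psum ^^ (L * Suc q)) ?B y \<le> d * (psum ^^ (L * Suc q)) ?J y" .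
  qed
qed

text \<open>The depth is j + a. Over interior points of level j the remaining a levels average like
  \<open>avg\<close> and give an error of at most \<open>e / 2\<close>; over boundary points only
  the bound \<open>M\<close> is used, and j makes these so rare, by the factor
  \<open>e / (2 * M)\<close>, that they contribute at most another \<open>e / 2\<close>.\<close>

lemma psum_uniform_equidistribution:
  fixes f :: "real ^ 'n::{finite,wellorder} \<Rightarrow> real"
  assumes f: "continuous_on \<Gamma> f" and e: "0 < e"
  defines "g \<equiv> \<lambda>x. f x - (LINT x|\<Gamma>_measure. f x)"
  obtains m where "\<And>y. y \<in> \<Gamma> \<Longrightarrow> \<bar>(psum ^^ m) g y\<bar> \<le> e * (psum ^^ m) (\<lambda>_. 1) y"
proof -
  let ?I = "LINT x|\<Gamma>_measure. f x"
  let ?J = "indicat_real (interior_pts :: (real ^ 'n::{finite,wellorder}) set)"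
  let ?B = "indicat_real (- interior_pts :: (real ^ 'n::{finite,wellorder}) set)"
  have g: "continuous_on \<Gamma> g" unfolding g_def by (intro continuous_intros f)
  obtain a where a: "\<And>y. y \<in> \<Gamma> \<Longrightarrow> \<bar>(avg ^^ a) f y - ?I\<bar> \<le> e / 2"
    using avg_uniform_limit[OF f, of "e / 2"] e by auto
  have ag: "(avg ^^ a) g y = (avg ^^ a) f y - ?I" for y
  proof -
    have "g = (\<lambda>x. 1 * f x + (-1) * ?I)" by (simp add: g_def)
    then show ?thesis by (simp only: avg_funpow_linear avg_funpow_const)
  qed
  obtain M where M: "0 < M" "\<And>x. x \<in> \<Gamma> \<Longrightarrow> \<bar>g x\<bar> \<le> M"
    using continuous_bounded_Gamma[OF g] by blast
  obtain j where j: "\<And>y. y \<in> \<Gamma> \<Longrightarrow> (psum ^^ j) ?B y \<le> e / (2 * M) * (psum ^^ j) ?J y"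
    using psum_boundary_negligible[of "e / (2 * M)"] e M(1) by auto
  have bound: "\<bar>(psum ^^ a) g z\<bar> \<le> (2 ^ a * (e / 2)) * ?J z + (2 ^ a * M) * ?B z" if z: "z \<in> \<Gamma>" for z
  proof (cases "z \<in> interior_pts")
    case True
    then show ?thesis using a[OF z] by (simp add: psum_funpow_interior[OF True] ag abs_mult)
  next
    case False
    have "\<bar>(psum ^^ a) g z\<bar> \<le> (psum ^^ a) (\<lambda>_. M) z" by (intro abs_psum_funpow_le M(2) z)
    also have "\<dots> \<le> 2 ^ a * (avg ^^ a) (\<lambda>_. M) z" by (intro psum_funpow_le_avg z) (use M in simp)
    finally show ?thesis using False by (simp add: avg_funpow_const)
  qed
  show thesis
  proof (rule that[of "j + a"])
    fix y :: "real ^ 'n::{finite,wellorder}"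
    assume y: "y \<in> \<Gamma>"
    have "\<bar>(psum ^^ (j + a)) g y\<bar> = \<bar>(psum ^^ j) ((psum ^^ a) g) y\<bar>" by (simp add: funpow_add)
    also have "\<dots> \<le> (psum ^^ j) (\<lambda>z. (2 ^ a * (e / 2)) * ?J z + (2 ^ a * M) * ?B z) y"
      by (intro abs_psum_funpow_le bound y)
    also have "\<dots> = (2 ^ a * (e / 2)) * (psum ^^ j) ?J y + (2 ^ a * M) * (psum ^^ j) ?B y"
      by (simp only: psum_funpow_linear)
    also have "\<dots> \<le> (2 ^ a * (e / 2)) * (psum ^^ j) ?J y + (2 ^ a * M) * (e / (2 * M) * (psum ^^ j) ?J y)"
      using M(1) by (intro add_left_mono mult_left_mono j y) auto
    also have "\<dots> = e * (2 ^ a * (psum ^^ j) ?J y + 0 * (psum ^^ j) (\<lambda>_. 0) y)"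
      using M(1) by (simp add: field_simps)
    also have "2 ^ a * (psum ^^ j) ?J y + 0 * (psum ^^ j) (\<lambda>_. 0) y = (psum ^^ j) (\<lambda>x. 2 ^ a * ?J x + 0 * 0) y"
      by (simp only: psum_funpow_linear)
    also have "e * \<dots> \<le> e * (psum ^^ j) ((psum ^^ a) (\<lambda>_. 1)) y"
    proof (intro mult_left_mono psum_funpow_mono y)
      fix x :: "real ^ 'n::{finite,wellorder}"
      assume x: "x \<in> \<Gamma>"
      show "2 ^ a * ?J x + 0 * 0 \<le> (psum ^^ a) (\<lambda>_. 1) x"
        using psum_funpow_nonneg[OF _ x, of "\<lambda>_. 1" a] psum_funpow_interior[of x a "\<lambda>_. 1"]
        by (cases "x \<in> interior_pts") (simp_all add: avg_funpow_const)
    qed (use e in simp)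
    also have "(psum ^^ j) ((psum ^^ a) (\<lambda>_. 1)) y = (psum ^^ (j + a)) (\<lambda>_. 1) y"
      by (simp add: funpow_add)
    finally show "\<bar>(psum ^^ (j + a)) g y\<bar> \<le> e * (psum ^^ (j + a)) (\<lambda>_. 1) y" .
  qed
qed

text \<open>This number of distinct m-th preimages is a block length in \<open>nat\<close> and a
  weight in the reals. Its bounds make blocks nonempty and of bounded length.\<close>

lemma psum_funpow_card:
  fixes y :: "real ^ 'n::{finite,wellorder}"
  shows "real ((psum ^^ m) (\<lambda>_. 1) y) = (psum ^^ m) (\<lambda>_. 1) y"
    and "1 \<le> (psum ^^ m) (\<lambda>_. 1 :: nat) y" and "(psum ^^ m) (\<lambda>_. 1 :: nat) y \<le> 2 ^ m"
proof (induction m arbitrary: y)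
  case (Suc m)
  note IH = Suc
  { case 1 show ?case by (simp add: psum_step IH(1) del: One_nat_def) }
  { case 2 show ?case using IH(2)[of "branch True y"] by (auto simp: psum_step) }
  { case 3 show ?case using IH(3)[of "branch True y"] IH(3)[of "branch False y"] by (auto simp: psum_step) }
qed auto

section \<open>Birkhoff averages of a single orbit\<close>

lemma abs_birkhoff_le:
  assumes "\<And>i. i < N \<Longrightarrow> \<bar>h ((Kmap ^^ i) x)\<bar> \<le> (g ((Kmap ^^ i) x) :: real)"
  shows "\<bar>birkhoff h N x\<bar> \<le> birkhoff g N x"
  unfolding birkhoff_def using assms by (intro order_trans[OF sum_abs] sum_mono) auto

text \<open>The constant pays for the time before the orbit reaches depth m and for one incomplete
  block at the end. It may depend on \<open>p\<close>, since it disappears in the average.\<close>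

lemma birkhoff_linear_bound:
  fixes p :: "real ^ 'n::{finite,wellorder}" and f :: "real ^ 'n::{finite,wellorder} \<Rightarrow> real"
  assumes p: "p \<in> \<Gamma>" and f: "continuous_on \<Gamma> f" and e: "0 < e"
  defines "g \<equiv> \<lambda>x. f x - (LINT x|\<Gamma>_measure. f x)"
  shows "\<exists>C. \<forall>k. \<bar>birkhoff g k p\<bar> \<le> e * real k + C"
proof -
  obtain m where m: "\<And>y. y \<in> \<Gamma> \<Longrightarrow> \<bar>(psum ^^ m) g y\<bar> \<le> e * (psum ^^ m) (\<lambda>_. 1) y"
    using psum_uniform_equidistribution[OF f e] unfolding g_def by blast
  have "continuous_on \<Gamma> g" unfolding g_def by (intro continuous_intros f)
  then obtain M where M: "0 < M" "\<And>x. x \<in> \<Gamma> \<Longrightarrow> \<bar>g x\<bar> \<le> M"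
    using continuous_bounded_Gamma by blast
  have crude: "\<bar>birkhoff g k x\<bar> \<le> M * real k" if "x \<in> \<Gamma>" for k x
    using abs_birkhoff_le[of k g x "\<lambda>_. M"] M(2)[OF Kmap_funpow_Gamma[OF that]]
    by (simp add: birkhoff_def mult.commute)
  obtain t y where y: "y \<in> \<Gamma>" and t: "(Kmap ^^ t) p = (branch False ^^ m) y"
    using reaches_base[OF p] by blast
  let ?x = "(branch False ^^ m) y"
  have x: "?x \<in> \<Gamma>" using y by (rule branch_funpow_Gamma)
  let ?l = "\<lambda>z. (psum ^^ m) (\<lambda>_. 1 :: nat) z"
  let ?N = "\<lambda>s. birkhoff ?l s y"
  \<comment> \<open>Any time N consists of s complete blocks and r steps into the next one, where
    block s lists the m-th preimages of the s-th orbit point of \<open>y\<close>.\<close>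
  have split: "\<exists>s r. N = ?N s + r \<and> r < ?l ((Kmap ^^ s) y)" for N
  proof (induction N)
    case 0
    show ?case using psum_funpow_card(2)[of m y]
      by (intro exI[of _ 0]) (simp add: birkhoff_def Suc_le_eq)
  next
    case (Suc N)
    then obtain s r where sr: "N = ?N s + r" "r < ?l ((Kmap ^^ s) y)" by blast
    show ?case
    proof (cases "Suc r < ?l ((Kmap ^^ s) y)")
      case True
      with sr(1) show ?thesis by (intro exI[of _ s] exI[of _ "Suc r"]) simp
    next
      case False
      with sr have "Suc N = ?N (Suc s) + 0" by (simp add: birkhoff_def)
      then show ?thesis using psum_funpow_card(2)[of m "(Kmap ^^ Suc s) y"]
        by (intro exI[of _ "Suc s"] exI[of _ 0]) (simp add: Suc_le_eq)
    qed
  qed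
  \<comment> \<open>Over complete blocks the orbit sum is a sum of preimage sums, to each of which
    the uniform estimate applies.\<close>
  have block: "\<bar>birkhoff g (?N s) ?x\<bar> \<le> e * real (?N s)" for s
  proof -
    have "\<bar>birkhoff g (?N s) ?x\<bar> = \<bar>birkhoff ((psum ^^ m) g) s y\<bar>"
      using birkhoff_psum_iterate[OF y, of g m s] by simp
    also have "\<dots> \<le> birkhoff (\<lambda>z. e * real (?l z)) s y"
      by (intro abs_birkhoff_le) (simp only: psum_funpow_card(1) m Kmap_funpow_Gamma y)
    also have "\<dots> = e * real (?N s)" by (simp add: birkhoff_def sum_distrib_left)
    finally show ?thesis .
  qed
  have from_x: "\<bar>birkhoff g N ?x\<bar> \<le> e * real N + M * 2 ^ m" for N
  proof -
    obtain s r where sr: "N = ?N s + r" "r < ?l ((Kmap ^^ s) y)" using split by blast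
    then have "r \<le> 2 ^ m" using psum_funpow_card(3)[of m "(Kmap ^^ s) y"] by linarith
    then have "real r \<le> 2 ^ m" by (metis of_nat_le_iff of_nat_numeral of_nat_power)
    then have "M * real r \<le> M * 2 ^ m" using M(1) by simp
    moreover have "\<bar>birkhoff g r ((Kmap ^^ ?N s) ?x)\<bar> \<le> M * real r"
      by (intro crude Kmap_funpow_Gamma x)
    moreover have "e * real (?N s) \<le> e * real N" using sr(1) e by simp
    moreover have "birkhoff g N ?x = birkhoff g (?N s) ?x + birkhoff g r ((Kmap ^^ ?N s) ?x)"
      by (simp only: sr(1) birkhoff_add)
    ultimately show ?thesis using block[of s] by linarith
  qed
  have "\<bar>birkhoff g k p\<bar> \<le> e * real k + (M * real t + M * 2 ^ m)" for k
  proof (cases "k \<le> t")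
    case True
    have "\<bar>birkhoff g k p\<bar> \<le> M * real t"
      using crude[OF p, of k] True M(1) by (meson mult_left_mono of_nat_mono less_imp_le order_trans)
    moreover have "0 \<le> e * real k" "0 \<le> M * 2 ^ m" using e M(1) by auto
    ultimately show ?thesis by linarith
  next
    case False
    then obtain N where k: "k = t + N" using le_Suc_ex nat_le_linear by blast
    have "birkhoff g k p = birkhoff g t p + birkhoff g N ?x" by (simp add: k birkhoff_add t)
    moreover have "e * real N \<le> e * real k" using k e by simp
    ultimately show ?thesis using crude[OF p, of t] from_x[of N] by linarith
  qed
  then show ?thesis by blast
qed

lemma averages_tendsto_0:
  fixes S :: "nat \<Rightarrow> real"
  assumes "\<And>e. 0 < e \<Longrightarrow> \<exists>C. \<forall>k. \<bar>S k\<bar> \<le> e * real k + C"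
  shows "(\<lambda>k. 1 / real k * S k) \<longlonglongrightarrow> 0"
proof (rule LIMSEQ_I)
  fix r :: real
  assume r: "0 < r"
  then obtain C where C: "\<And>k. \<bar>S k\<bar> \<le> r / 2 * real k + C" using assms[of "r / 2"] by auto
  obtain n where n: "2 * C / r < real n" using reals_Archimedean2 by blast
  show "\<exists>no. \<forall>k\<ge>no. norm (1 / real k * S k - 0) < r"
  proof (intro exI[of _ "Suc n"] allI impI)
    fix k assume k: "Suc n \<le> k"
    then have "2 * C / r < real k" "0 < real k" using n by linarith+
    then have "C < r / 2 * real k" using r by (simp add: field_simps)
    then have "\<bar>S k\<bar> < r * real k" using C[of k] by (simp add: algebra_simps)
    then show "norm (1 / real k * S k - 0) < r" using \<open>0 < real k\<close> by (simp add: field_simps abs_mult)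
  qed
qed

theorem theorem4p6:
  fixes p :: "real ^ 'n::{finite,wellorder}" and f :: "real ^ 'n::{finite,wellorder} \<Rightarrow> real"
  assumes "p \<in> \<Gamma>"
    and "continuous_on \<Gamma> f"
  shows "(\<lambda>k. (1 / real k) * (\<Sum>i<k. f ((Kmap ^^ i) p)))
           \<longlonglongrightarrow> (LINT x|\<Gamma>_measure. f x)"
proof -
  let ?I = "LINT x|\<Gamma>_measure. f x"
  let ?S = "\<lambda>k. birkhoff (\<lambda>x. f x - ?I) k p"
  have "(\<lambda>k. 1 / real k * ?S k) \<longlonglongrightarrow> 0"
    by (rule averages_tendsto_0) (rule birkhoff_linear_bound[OF assms])
  then have "(\<lambda>k. 1 / real k * ?S k + ?I) \<longlonglongrightarrow> ?I"
    using tendsto_add[OF _ tendsto_const, of _ 0 sequentially ?I] by simp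
  \<comment> \<open>At k = 0 the left side is \<open>?I\<close> and the right side is 0, so the
    identity is claimed only eventually.\<close>
  moreover have "eventually (\<lambda>k. 1 / real k * ?S k + ?I =
      (1 / real k) * (\<Sum>i<k. f ((Kmap ^^ i) p))) sequentially"
    using eventually_gt_at_top[of 0]
    by eventually_elim (simp add: birkhoff_def sum_subtractf field_simps)
  ultimately show ?thesis by (rule Lim_transform_eventually)
qed

end
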